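(* For any $\varepsilon>0$, there are undirected networks over time $N=(G,u,b,\tau,T)$ in which $B$ units of flow can be sent within time horizon $T$, where $B=\sum_{v:\,b_v>0}b_v$, but in every orientation $\overrightarrow{N}$ of $N$ at most $B/3+\varepsilon$ units of flow can be sent within time horizon $T$.
   Context: An undirected network over time $N=(G,u,b,\tau,T)$ consists of a finite undirected (multi)graph $G=(V,E)$, capacities $u_e\ge 0$ and transit times $\tau_e\ge 0$ for $e\in E$, balances $b_v\in\mathbb{R}$ with $\sum_v b_v=0$, and a time horizon $T\ge 0$. Sources are $S^+=\{v: b_v>0\}$, sinks $S^-=\{v:b_v<0\}$. An orientation of $N$ replaces every edge $\{v,w\}$ by exactly one of the arcs $(v,w),(w,v)$ with the same capacity and transit time (parallel edges oriented independently). A flow over time in a directed network assigns to each arc $e$ a Lebesgue-integrable inflow rate $f_e:[0,T)\to\mathbb{R}_{\ge0}$ with $f_e\le u_e$ and $f_e(\theta)=0$ for $\theta\ge T-\tau_e$; flow entering at $\theta$ leaves at $\theta+\tau_e$. With excess $\mathrm{ex}(v,\theta)=\sum_{e\in\delta^-(v)}\int_0^{\theta-\tau_e}f_e-\sum_{e\in\delta^+(v)}\int_0^{\theta}f_e$, flow conservation requires: $\mathrm{ex}(v,T)=0$ and $\mathrm{ex}(v,\theta)\ge0$ for non-terminals; $-b_v\le\mathrm{ex}(v,\theta)\le0$ for sources; $0\le\mathrm{ex}(v,\theta)\le-b_v$ for sinks. The value is $|f|=\sum_{v\in S^-}\mathrm{ex}(v,T)$. In an undirected network flow may use each edge in both directions,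 the inflow rates in both directions together bounded by $u_e$, each direction with transit time $\tau_e$. "$x$ units of flow can be sent within time horizon $T$" means a flow over time with horizon $T$ satisfying these constraints and of value at least $x$ exists. *)

theory Defs
  imports "HOL-Analysis.Analysis" "Graph_Theory.Digraph"
begin

record ('v, 'e) undirected_network =
  vertices :: "'v set"
  edges :: "'e set"
  ends :: "'e \<Rightarrow> 'v set"
  capacity :: "'e \<Rightarrow> real"
  transit :: "'e \<Rightarrow> real"
  balance :: "'v \<Rightarrow> real"
  horizon :: real

record ('v, 'e) directed_network =
  graph :: "('v, 'e) pre_digraph"
  dcapacity :: "'e \<Rightarrow> real"
  dtransit :: "'e \<Rightarrow> real"
  dbalance :: "'v \<Rightarrow> real"
  dhorizon :: real

text \<open>Parallel edges are distinct edges with the same set of ends.\<close>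

definition undirected_network_over_time :: "('v, 'e) undirected_network \<Rightarrow> bool" where
  "undirected_network_over_time N \<longleftrightarrow>
     finite (vertices N) \<and> finite (edges N) \<and>
     (\<forall>e\<in>edges N. ends N e \<subseteq> vertices N \<and> card (ends N e) = 2) \<and>
     (\<forall>e\<in>edges N. 0 \<le> capacity N e \<and> 0 \<le> transit N e) \<and>
     (\<Sum>v\<in>vertices N. balance N v) = 0 \<and>
     0 \<le> horizon N"

definition total_supply :: "('v, 'e) undirected_network \<Rightarrow> real" where
  "total_supply N = (\<Sum>v | v \<in> vertices N \<and> balance N v > 0. balance N v)"

definition is_orientation :: "('v, 'e) undirected_network \<Rightarrow> ('v, 'e) directed_network \<Rightarrow> bool" where
  "is_orientation N D \<longleftrightarrow>
     verts (graph D) = vertices N \<and> arcs (graph D) = edges N \<and>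
     (\<forall>e\<in>edges N. {tail (graph D) e, head (graph D) e} = ends N e) \<and>
     dcapacity D = capacity N \<and> dtransit D = transit N \<and>
     dbalance D = balance N \<and> dhorizon D = horizon N"

text \<open>
  In the following, \<open>f a \<theta>\<close> is the rate at which flow enters arc \<open>a\<close> at time \<open>\<theta>\<close>; only the values
  for \<open>\<theta>\<close> in \<open>{0..<T}\<close> are relevant. Capacities are treated separately, because the two
  directions of an undirected edge share one capacity.
\<close>

definition inflow_rates ::
  "('v, 'a) pre_digraph \<Rightarrow> ('a \<Rightarrow> real) \<Rightarrow> real \<Rightarrow> ('a \<Rightarrow> real \<Rightarrow> real) \<Rightarrow> bool" where
  "inflow_rates G \<tau> T f \<longleftrightarrow>
     (\<forall>a\<in>arcs G.
        set_integrable lebesgue {0..<T} (f a) \<and>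
        (\<forall>\<theta>\<in>{0..<T}. 0 \<le> f a \<theta>) \<and>
        (\<forall>\<theta>\<in>{0..<T}. T - \<tau> a \<le> \<theta> \<longrightarrow> f a \<theta> = 0))"

text \<open>For \<open>\<theta> < \<tau> a\<close> the first integral is over the empty set and thus zero.\<close>

definition excess ::
  "('v, 'a) pre_digraph \<Rightarrow> ('a \<Rightarrow> real) \<Rightarrow> ('a \<Rightarrow> real \<Rightarrow> real) \<Rightarrow> 'v \<Rightarrow> real \<Rightarrow> real" where
  "excess G \<tau> f v \<theta> =
     (\<Sum>a\<in>in_arcs G v. LINT \<xi>:{0..<\<theta> - \<tau> a}|lebesgue. f a \<xi>) -
     (\<Sum>a\<in>out_arcs G v. LINT \<xi>:{0..<\<theta>}|lebesgue. f a \<xi>)"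

definition flow_conservation ::
  "('v, 'a) pre_digraph \<Rightarrow> ('a \<Rightarrow> real) \<Rightarrow> ('v \<Rightarrow> real) \<Rightarrow> real \<Rightarrow> ('a \<Rightarrow> real \<Rightarrow> real) \<Rightarrow> bool" where
  "flow_conservation G \<tau> b T f \<longleftrightarrow>
     (\<forall>v\<in>verts G.
        (b v = 0 \<longrightarrow> excess G \<tau> f v T = 0 \<and> (\<forall>\<theta>\<in>{0..T}. 0 \<le> excess G \<tau> f v \<theta>)) \<and>
        (b v > 0 \<longrightarrow> (\<forall>\<theta>\<in>{0..T}. - b v \<le> excess G \<tau> f v \<theta> \<and> excess G \<tau> f v \<theta> \<le> 0)) \<and>
        (b v < 0 \<longrightarrow> (\<forall>\<theta>\<in>{0..T}. 0 \<le> excess G \<tau> f v \<theta> \<and> excess G \<tau> f v \<theta> \<le> - b v)))"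

definition flow_value ::
  "('v, 'a) pre_digraph \<Rightarrow> ('a \<Rightarrow> real) \<Rightarrow> ('v \<Rightarrow> real) \<Rightarrow> real \<Rightarrow> ('a \<Rightarrow> real \<Rightarrow> real) \<Rightarrow> real" where
  "flow_value G \<tau> b T f = (\<Sum>v | v \<in> verts G \<and> b v < 0. excess G \<tau> f v T)"

definition directed_flow_over_time ::
  "('v, 'e) directed_network \<Rightarrow> ('e \<Rightarrow> real \<Rightarrow> real) \<Rightarrow> bool" where
  "directed_flow_over_time D f \<longleftrightarrow>
     inflow_rates (graph D) (dtransit D) (dhorizon D) f \<and>
     (\<forall>e\<in>arcs (graph D). \<forall>\<theta>\<in>{0..<dhorizon D}. f e \<theta> \<le> dcapacity D e) \<and>
     flow_conservation (graph D) (dtransit D) (dbalance D) (dhorizon D) f"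

definition directed_can_send :: "('v, 'e) directed_network \<Rightarrow> real \<Rightarrow> bool" where
  "directed_can_send D x \<longleftrightarrow>
     (\<exists>f. directed_flow_over_time D f \<and>
          x \<le> flow_value (graph D) (dtransit D) (dbalance D) (dhorizon D) f)"

text \<open>The arc \<open>(e, v, w)\<close> stands for the edge \<open>e\<close> traversed from \<open>v\<close> to \<open>w\<close>.\<close>

definition bidirection :: "('v, 'e) undirected_network \<Rightarrow> ('v, 'e \<times> 'v \<times> 'v) pre_digraph" where
  "bidirection N =
     \<lparr>verts = vertices N,
      arcs = {(e, v, w). e \<in> edges N \<and> ends N e = {v, w}},
      tail = (\<lambda>(e, v, w). v),
      head = (\<lambda>(e, v, w). w)\<rparr>"

definition undirected_flow_over_time ::
  "('v, 'e) undirected_network \<Rightarrow> ('e \<times> 'v \<times> 'v \<Rightarrow> real \<Rightarrow> real) \<Rightarrow> bool" where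
  "undirected_flow_over_time N f \<longleftrightarrow>
     inflow_rates (bidirection N) (\<lambda>(e, _). transit N e) (horizon N) f \<and>
     (\<forall>e\<in>edges N. \<forall>v w. ends N e = {v, w} \<longrightarrow>
        (\<forall>\<theta>\<in>{0..<horizon N}. f (e, v, w) \<theta> + f (e, w, v) \<theta> \<le> capacity N e)) \<and>
     flow_conservation (bidirection N) (\<lambda>(e, _). transit N e) (balance N) (horizon N) f"

definition undirected_can_send :: "('v, 'e) undirected_network \<Rightarrow> real \<Rightarrow> bool" where
  "undirected_can_send N x \<longleftrightarrow>
     (\<exists>f. undirected_flow_over_time N f \<and>
          x \<le> flow_value (bidirection N) (\<lambda>(e, _). transit N e) (balance N) (horizon N) f)"

end

theory Submission
  imports Defs "HOL-Library.Countable" "HOL-Real_Asymp.Real_Asymp"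
begin

text \<open>
  The network consists of gadgets \<open>g\<close>, each a star with a centre and three ports \<open>p, a, b\<close>. Every
  gadget is used by three of the unit flows: one starts at \<open>p\<close> and leaves through \<open>a\<close> (role S), one
  crosses from \<open>a\<close> to \<open>b\<close> (role P), one enters through \<open>b\<close> and ends at \<open>p\<close> (role D). Any two of these
  roles traverse some spoke in opposite directions, so an orientation of the star keeps at most one of
  them. A flow has to take a role S, a role P and a role D, in three different gadgets, so
  an orientation can serve about one third of the flows, provided that no detour helps.

  Detours are excluded by timing. At each gadget the time windows of the roles are ordered D, P, S, so
  a flow starting at \<open>p\<close> leaves through \<open>b\<close> too late, and a flow entering through \<open>a\<close> reaches \<open>p\<close>
  too late. The window lengths live on very different scales, which also bounds the amount that can
  take role P at a gadget by about one unit, since the spoke capacity is the reciprocal of the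
  length of that window. Undirected, the windows are disjoint and all roles are feasible.

  The upper bound for an orientation comes from three cuts over time: one in which only the supplies
  at gadgets that keep role S count, one in which only the demands at gadgets that keep role D count, and
  one that is crossed only at gadgets that keep role P.
\<close>

lemma set_integrable_subinterval:
  fixes f :: "real \<Rightarrow> real"
  assumes "set_integrable lebesgue {0..<T} f" "0 \<le> x" "y \<le> T"
  shows "set_integrable lebesgue {x..<y} f"
  by (rule set_integrable_subset[OF assms(1)]) (use assms in auto)

lemma set_integrable_const_interval:
  fixes x y c :: real
  shows "set_integrable lebesgue {x..<y} (\<lambda>_. c)"
proof -
  have "{x..<y} \<in> lmeasurable"
    by (intro bounded_set_imp_lmeasurable bounded_subset[OF bounded_closed_interval[of x y]]) auto
  then have "integrable lebesgue (indicator {x..<y} :: real \<Rightarrow> real)"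
    by (intro integrable_real_indicator) (auto simp: fmeasurable_def)
  then show ?thesis by (simp add: set_integrable_def)
qed

lemma set_integral_diff_le:
  fixes f :: "real \<Rightarrow> real"
  assumes int: "set_integrable lebesgue {0..<T} f"
    and bounds: "\<And>\<theta>. \<theta> \<in> {0..<T} \<Longrightarrow> 0 \<le> f \<theta> \<and> f \<theta> \<le> u"
    and "0 \<le> y" "y \<le> T" "x \<le> T" "0 \<le> u"
  shows "(LINT \<xi>:{0..<x}|lebesgue. f \<xi>) - (LINT \<xi>:{0..<y}|lebesgue. f \<xi>) \<le> u * max 0 (x - y)"
proof (cases "x \<le> y")
  case True
  define x' where "x' = max 0 x"
  have x': "0 \<le> x'" "x' \<le> y" using True assms by (auto simp: x'_def)
  have eq: "{0..<x} = {0..<x'}" by (auto simp: x'_def)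
  have "(LINT \<xi>:{0..<y}|lebesgue. f \<xi>) = (LINT \<xi>:{0..<x'} \<union> {x'..<y}|lebesgue. f \<xi>)"
    using x' by (simp add: ivl_disj_un)
  also have "\<dots> = (LINT \<xi>:{0..<x'}|lebesgue. f \<xi>) + (LINT \<xi>:{x'..<y}|lebesgue. f \<xi>)"
    by (rule set_integral_Un) (use x' assms in \<open>auto intro!: set_integrable_subinterval[OF int]\<close>)
  finally have "(LINT \<xi>:{0..<y}|lebesgue. f \<xi>)
    = (LINT \<xi>:{0..<x'}|lebesgue. f \<xi>) + (LINT \<xi>:{x'..<y}|lebesgue. f \<xi>)" .
  moreover have "0 \<le> (LINT \<xi>:{x'..<y}|lebesgue. f \<xi>)"
    unfolding set_lebesgue_integral_def
    by (rule integral_nonneg_AE) (use x' assms in \<open>auto simp: indicator_def\<close>)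
  ultimately show ?thesis using True unfolding eq by simp
next
  case False
  have "(LINT \<xi>:{0..<x}|lebesgue. f \<xi>) = (LINT \<xi>:{0..<y} \<union> {y..<x}|lebesgue. f \<xi>)"
    using False assms by (simp add: ivl_disj_un)
  also have "\<dots> = (LINT \<xi>:{0..<y}|lebesgue. f \<xi>) + (LINT \<xi>:{y..<x}|lebesgue. f \<xi>)"
    by (rule set_integral_Un) (use assms in \<open>auto intro!: set_integrable_subinterval[OF int]\<close>)
  also have "(LINT \<xi>:{y..<x}|lebesgue. f \<xi>) \<le> (LINT \<xi>:{y..<x}|lebesgue. u)"
    by (rule set_integral_mono)
       (use assms in \<open>auto intro!: set_integrable_subinterval[OF int] set_integrable_const_interval\<close>)
  also have "(LINT \<xi>:{y..<x}|lebesgue. u) = u * (x - y)"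
    using False by (simp add: set_lebesgue_integral_def)
  finally show ?thesis using False by simp
qed

lemma (in fin_digraph) flow_value_le_cut:
  assumes rates: "inflow_rates G \<tau> T f"
    and cap: "\<And>a \<theta>. a \<in> arcs G \<Longrightarrow> \<theta> \<in> {0..<T} \<Longrightarrow> f a \<theta> \<le> u a"
    and cons: "flow_conservation G \<tau> b T f"
    and u: "\<And>a. a \<in> arcs G \<Longrightarrow> 0 \<le> u a"
    and \<tau>: "\<And>a. a \<in> arcs G \<Longrightarrow> 0 \<le> \<tau> a"
    and \<alpha>: "\<And>v. v \<in> verts G \<Longrightarrow> 0 \<le> \<alpha> v \<and> \<alpha> v \<le> T"
  shows "flow_value G \<tau> b T f
    \<le> (\<Sum>a\<in>arcs G. u a * max 0 (\<alpha> (head G a) - \<tau> a - \<alpha> (tail G a)))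
      + (\<Sum>v | v \<in> verts G \<and> 0 < b v \<and> 0 < \<alpha> v. b v)
      + (\<Sum>v | v \<in> verts G \<and> b v < 0 \<and> \<alpha> v < T. - b v)"
proof -
  let ?I = "\<lambda>a x. LINT \<xi>:{0..<x}|lebesgue. f a \<xi>"
  let ?ex = "excess G \<tau> f"
  have zero: "?ex v 0 = 0" for v
  proof -
    have "?I a (0 - \<tau> a) = 0" if "a \<in> in_arcs G v" for a
    proof -
      have "{0..<- \<tau> a} = {}" using \<tau>[of a] that by auto
      then show ?thesis by (simp add: set_lebesgue_integral_def)
    qed
    then have "(\<Sum>a\<in>in_arcs G v. ?I a (0 - \<tau> a)) = 0"
      by (intro sum.neutral) blast
    then show ?thesis by (simp add: excess_def set_lebesgue_integral_def)
  qed
  have vertex: "(if b v < 0 then ?ex v T else 0)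
      \<le> ?ex v (\<alpha> v) + (if 0 < b v \<and> 0 < \<alpha> v then b v else 0) + (if b v < 0 \<and> \<alpha> v < T then - b v else 0)"
    if v: "v \<in> verts G" for v
  proof -
    have mem: "\<alpha> v \<in> {0..T}" "T \<in> {0..T}" using \<alpha>[OF v] by auto
    note c = cons[unfolded flow_conservation_def, rule_format, OF v]
    consider "b v = 0" | "0 < b v" | "b v < 0" by linarith
    then show ?thesis
    proof cases
      case 1 then show ?thesis using c mem by auto
    next
      case 2
      then have "- b v \<le> ?ex v (\<alpha> v)" using c mem by auto
      moreover have "\<alpha> v = 0 \<or> 0 < \<alpha> v" using mem by auto
      ultimately show ?thesis using 2 zero by auto
    next
      case 3
      then have "0 \<le> ?ex v (\<alpha> v)" "?ex v T \<le> - b v" using c mem by auto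
      moreover have "\<alpha> v = T \<or> \<alpha> v < T" using mem by auto
      ultimately show ?thesis using 3 by auto
    qed
  qed
  have "flow_value G \<tau> b T f = (\<Sum>v\<in>verts G. if b v < 0 then ?ex v T else 0)"
    unfolding flow_value_def by (subst sum.inter_filter[symmetric]) auto
  also have "\<dots> \<le> (\<Sum>v\<in>verts G. ?ex v (\<alpha> v) + (if 0 < b v \<and> 0 < \<alpha> v then b v else 0)
      + (if b v < 0 \<and> \<alpha> v < T then - b v else 0))"
    by (rule sum_mono) (rule vertex)
  also have "\<dots> = (\<Sum>v\<in>verts G. ?ex v (\<alpha> v))
      + (\<Sum>v | v \<in> verts G \<and> 0 < b v \<and> 0 < \<alpha> v. b v)
      + (\<Sum>v | v \<in> verts G \<and> b v < 0 \<and> \<alpha> v < T. - b v)"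
    by (simp add: sum.distrib sum.inter_filter)
  also have "(\<Sum>v\<in>verts G. ?ex v (\<alpha> v))
      = (\<Sum>a\<in>arcs G. ?I a (\<alpha> (head G a) - \<tau> a) - ?I a (\<alpha> (tail G a)))"
  proof -
    have "(\<Sum>v\<in>verts G. \<Sum>a\<in>in_arcs G v. ?I a (\<alpha> v - \<tau> a))
      = (\<Sum>v\<in>verts G. \<Sum>a | a \<in> arcs G \<and> head G a = v. ?I a (\<alpha> (head G a) - \<tau> a))"
      by (intro sum.cong) (auto simp: in_arcs_def)
    also have "\<dots> = (\<Sum>a\<in>arcs G. ?I a (\<alpha> (head G a) - \<tau> a))"
      by (rule sum.group) auto
    finally have 1: "(\<Sum>v\<in>verts G. \<Sum>a\<in>in_arcs G v. ?I a (\<alpha> v - \<tau> a))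
      = (\<Sum>a\<in>arcs G. ?I a (\<alpha> (head G a) - \<tau> a))" .
    have "(\<Sum>v\<in>verts G. \<Sum>a\<in>out_arcs G v. ?I a (\<alpha> v))
      = (\<Sum>v\<in>verts G. \<Sum>a | a \<in> arcs G \<and> tail G a = v. ?I a (\<alpha> (tail G a)))"
      by (intro sum.cong) (auto simp: out_arcs_def)
    also have "\<dots> = (\<Sum>a\<in>arcs G. ?I a (\<alpha> (tail G a)))"
      by (rule sum.group) auto
    finally show ?thesis
      unfolding excess_def sum_subtractf 1 by simp
  qed
  also have "\<dots> \<le> (\<Sum>a\<in>arcs G. u a * max 0 (\<alpha> (head G a) - \<tau> a - \<alpha> (tail G a)))"
  proof (rule sum_mono)
    fix a assume a: "a \<in> arcs G"
    have r: "set_integrable lebesgue {0..<T} (f a)" "\<And>\<theta>. \<theta> \<in> {0..<T} \<Longrightarrow> 0 \<le> f a \<theta> \<and> f a \<theta> \<le> u a"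
      using rates a cap[OF a] unfolding inflow_rates_def by auto
    show "?I a (\<alpha> (head G a) - \<tau> a) - ?I a (\<alpha> (tail G a))
      \<le> u a * max 0 (\<alpha> (head G a) - \<tau> a - \<alpha> (tail G a))"
      by (rule set_integral_diff_le[OF r])
         (use a u[OF a] \<tau>[OF a] \<alpha>[of "head G a"] \<alpha>[of "tail G a"] in auto)
  qed
  finally show ?thesis by simp
qed

definition pulse :: "real \<Rightarrow> real \<Rightarrow> real \<Rightarrow> real \<Rightarrow> real" where
  "pulse t l r \<theta> = (if t \<le> \<theta> \<and> \<theta> < t + l then r else 0)"

definition pulse_total :: "real \<Rightarrow> real \<Rightarrow> real \<Rightarrow> real" where
  "pulse_total l r y = r * min (max 0 y) l"

lemma set_integrable_pulse: "set_integrable lebesgue {a..<b} (pulse t l r)"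
proof -
  have "(\<lambda>\<xi>. indicator {a..<b} \<xi> *\<^sub>R pulse t l r \<xi>)
    = (\<lambda>\<xi>. indicator {max a t..<min b (t + l)} \<xi> *\<^sub>R r)"
    by (auto simp: pulse_def indicator_def)
  then show ?thesis
    using set_integrable_const_interval[of "max a t" "min b (t + l)" r] by (simp add: set_integrable_def)
qed

lemma set_integral_pulse:
  assumes "0 \<le> t" "0 \<le> l"
  shows "(LINT \<xi>:{0..<x}|lebesgue. pulse t l r \<xi>) = pulse_total l r (x - t)"
proof -
  have eq: "(\<lambda>\<xi>. indicator {0..<x} \<xi> *\<^sub>R pulse t l r \<xi>)
    = (\<lambda>\<xi>. indicator {t..<min x (t + l)} \<xi> *\<^sub>R r)"
    using assms by (auto simp: pulse_def indicator_def)
  have "measure lebesgue {t..<min x (t + l)} = max 0 (min x (t + l) - t)"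
    by (cases "t \<le> min x (t + l)") (auto simp: max_def)
  then have "(LINT \<xi>:{0..<x}|lebesgue. pulse t l r \<xi>) = max 0 (min x (t + l) - t) * r"
    unfolding set_lebesgue_integral_def eq by simp
  also have "max 0 (min x (t + l) - t) = min (max 0 (x - t)) l"
    using assms by auto
  finally show ?thesis by (simp add: pulse_total_def)
qed

locale walk_family = fin_digraph G
  for G :: "('v, 'a) pre_digraph" +
  fixes \<tau> :: "'a \<Rightarrow> real" and T :: real
    and J :: "'i set" and n :: nat
    and p :: "'i \<Rightarrow> nat \<Rightarrow> 'a" and x :: "'i \<Rightarrow> nat \<Rightarrow> 'v" and t :: "'i \<Rightarrow> nat \<Rightarrow> real"
    and l r :: "'i \<Rightarrow> real"
  assumes finite_J: "finite J"
    and p_arc: "\<And>i m. i \<in> J \<Longrightarrow> m < n \<Longrightarrow> p i m \<in> arcs G"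
    and tail_p: "\<And>i m. i \<in> J \<Longrightarrow> m < n \<Longrightarrow> tail G (p i m) = x i m"
    and head_p: "\<And>i m. i \<in> J \<Longrightarrow> m < n \<Longrightarrow> head G (p i m) = x i (Suc m)"
    and t_0: "\<And>i. i \<in> J \<Longrightarrow> t i 0 = 0"
    and t_Suc: "\<And>i m. i \<in> J \<Longrightarrow> m < n \<Longrightarrow> t i (Suc m) = t i m + \<tau> (p i m)"
    and \<tau>_nonneg: "\<And>a. a \<in> arcs G \<Longrightarrow> 0 \<le> \<tau> a"
    and l_nonneg: "\<And>i. i \<in> J \<Longrightarrow> 0 \<le> l i"
    and r_nonneg: "\<And>i. i \<in> J \<Longrightarrow> 0 \<le> r i"
    and t_n: "\<And>i. i \<in> J \<Longrightarrow> t i n + l i \<le> T"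
begin

definition walk_flow :: "'a \<Rightarrow> real \<Rightarrow> real" where
  "walk_flow a \<theta> = (\<Sum>i\<in>J. \<Sum>m<n. if p i m = a then pulse (t i m) (l i) (r i) \<theta> else 0)"

lemma t_mono:
  assumes "i \<in> J" "m \<le> m'" "m' \<le> n"
  shows "t i m \<le> t i m'"
  using assms(2,3)
proof (induction m' rule: dec_induct)
  case (step m')
  then show ?case using t_Suc[of i m'] \<tau>_nonneg[of "p i m'"] p_arc[of i m'] assms(1) by fastforce
qed simp

lemma t_nonneg: "i \<in> J \<Longrightarrow> m \<le> n \<Longrightarrow> 0 \<le> t i m"
  using t_mono[of i 0 m] t_0 by simp

lemma set_integrable_walk_pulse:
  "set_integrable lebesgue {u..<v} (\<lambda>\<xi>. if p i m = a then pulse (t i m) (l i) (r i) \<xi> else 0)"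
  by (cases "p i m = a") (simp_all add: set_integrable_pulse set_integrable_const_interval)

lemma set_integrable_walk_flow: "set_integrable lebesgue {u..<v} (walk_flow a)"
  using set_integrable_walk_pulse
  unfolding walk_flow_def set_integrable_def scaleR_sum_right
  by (intro Bochner_Integration.integrable_sum)

lemma set_integral_walk_flow:
  "(LINT \<xi>:{0..<y}|lebesgue. walk_flow a \<xi>)
    = (\<Sum>i\<in>J. \<Sum>m<n. if p i m = a then pulse_total (l i) (r i) (y - t i m) else 0)"
proof -
  have "(LINT \<xi>:{0..<y}|lebesgue. walk_flow a \<xi>)
    = (\<Sum>i\<in>J. \<Sum>m<n. LINT \<xi>:{0..<y}|lebesgue. if p i m = a then pulse (t i m) (l i) (r i) \<xi> else 0)"
    using set_integrable_walk_pulse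
    unfolding walk_flow_def set_lebesgue_integral_def set_integrable_def scaleR_sum_right
    by (subst Bochner_Integration.integral_sum, (intro Bochner_Integration.integrable_sum, blast))
      (intro sum.cong refl Bochner_Integration.integral_sum)
  also have "\<dots> = (\<Sum>i\<in>J. \<Sum>m<n. if p i m = a then pulse_total (l i) (r i) (y - t i m) else 0)"
    by (intro sum.cong refl) (auto simp: set_integral_pulse[unfolded set_lebesgue_integral_def real_scaleR_def]
        t_nonneg l_nonneg set_lebesgue_integral_def)
  finally show ?thesis .
qed

lemma inflow_rates_walk_flow: "inflow_rates G \<tau> T walk_flow"
proof -
  have "pulse (t i m) (l i) (r i) \<theta> = 0"
    if "i \<in> J" "m < n" "p i m = a" "T - \<tau> a \<le> \<theta>" for i m a \<theta>
    using that t_Suc[of i m] t_mono[of i "Suc m" n] t_n[of i] by (simp add: pulse_def)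
  then show ?thesis
    unfolding inflow_rates_def
    by (auto simp: set_integrable_walk_flow walk_flow_def pulse_def r_nonneg intro!: sum_nonneg sum.neutral)
qed

lemma excess_walk_flow:
  assumes "v \<in> verts G"
  shows "excess G \<tau> walk_flow v \<theta>
    = (\<Sum>i\<in>J. (if x i n = v then pulse_total (l i) (r i) (\<theta> - t i n) else 0)
        - (if x i 0 = v then pulse_total (l i) (r i) \<theta> else 0))"
proof -
  let ?\<phi> = "\<lambda>i m. if x i m = v then pulse_total (l i) (r i) (\<theta> - t i m) else 0"
  have swap: "(\<Sum>a\<in>S. \<Sum>i\<in>J. \<Sum>m<n. if p i m = a then h i m a else 0)
    = (\<Sum>i\<in>J. \<Sum>m<n. if p i m \<in> S then h i m (p i m) else 0)" if "finite S" for S h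
  proof -
    have "(\<Sum>a\<in>S. \<Sum>i\<in>J. \<Sum>m<n. if p i m = a then h i m a else 0)
      = (\<Sum>i\<in>J. \<Sum>a\<in>S. \<Sum>m<n. if p i m = a then h i m a else 0)" by (rule sum.swap)
    also have "\<dots> = (\<Sum>i\<in>J. \<Sum>m<n. \<Sum>a\<in>S. if p i m = a then h i m a else 0)"
      by (intro sum.cong refl) (rule sum.swap)
    finally show ?thesis using that by simp
  qed
  have "excess G \<tau> walk_flow v \<theta>
    = (\<Sum>i\<in>J. \<Sum>m<n. if p i m \<in> in_arcs G v then pulse_total (l i) (r i) (\<theta> - \<tau> (p i m) - t i m) else 0)
    - (\<Sum>i\<in>J. \<Sum>m<n. if p i m \<in> out_arcs G v then pulse_total (l i) (r i) (\<theta> - t i m) else 0)"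
    unfolding excess_def set_integral_walk_flow
    by (subst (1 2) swap) (simp_all add: in_arcs_def out_arcs_def)
  also have "\<dots> = (\<Sum>i\<in>J. \<Sum>m<n. ?\<phi> i (Suc m) - ?\<phi> i m)"
    unfolding sum_subtractf[symmetric]
    by (intro sum.cong refl) (auto simp: p_arc tail_p head_p t_Suc algebra_simps)
  also have "\<dots> = (\<Sum>i\<in>J. ?\<phi> i n - ?\<phi> i 0)"
    by (intro sum.cong refl) (rule sum_lessThan_telescope)
  also have "\<dots> = (\<Sum>i\<in>J. (if x i n = v then pulse_total (l i) (r i) (\<theta> - t i n) else 0)
      - (if x i 0 = v then pulse_total (l i) (r i) \<theta> else 0))"
    by (intro sum.cong refl) (simp add: t_0)
  finally show ?thesis .
qed

end

datatype 'i vertex = Centre 'i | PortP 'i | PortA 'i | PortB 'i | Source 'i | Sink 'i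

datatype 'i edge = SpokeP 'i | SpokeA 'i | SpokeB 'i | SourceE 'i | LinkA 'i | LinkB 'i | SinkE 'i

instance vertex :: (countable) countable by countable_datatype

instance edge :: (countable) countable by countable_datatype

text \<open>
  The flow of path \<open>i\<close> takes role S at \<open>src i\<close>, role P at \<open>i\<close> and role D at \<open>snk i\<close>. Times at gadget
  \<open>g\<close> are measured relative to \<open>H * (lev g + 1)\<close>. If \<open>i\<close> is a path, then role P takes place in
  \<open>[0, L i)\<close>, role S at \<open>src i\<close> in \<open>[A (src i), A (src i) + L i)\<close>, and role D at \<open>snk i\<close> in
  \<open>[- G (snk i) - L i, - G (snk i))\<close>. The numbers \<open>A\<close> and \<open>Y\<close> are the lateness, \<open>E\<close>, \<open>G\<close> and \<open>Z\<close> the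
  earliness of the ports in the three cuts; their recursive inequalities say that no link crosses a cut.
\<close>

locale gadget_network =
  fixes I J :: "'i::countable set" and src snk :: "'i \<Rightarrow> 'i" and lev :: "'i \<Rightarrow> nat"
    and L A G Y Z E :: "'i \<Rightarrow> real" and H c T :: real
  assumes finite_I: "finite I" and J_subset: "J \<subseteq> I"
    and src_in: "i \<in> J \<Longrightarrow> src i \<in> I" and snk_in: "i \<in> J \<Longrightarrow> snk i \<in> I"
    and inj_src: "inj_on src J" and inj_snk: "inj_on snk J"
    and lev_src: "i \<in> J \<Longrightarrow> lev i = Suc (lev (src i))"
    and lev_snk: "i \<in> J \<Longrightarrow> lev (snk i) = Suc (lev i)"
    and c_pos: "0 < c"
    and gadget_bounds: "g \<in> I \<Longrightarrow> 0 < L g \<and> L g \<le> A g \<and> A g \<le> Y g \<and> Y g \<le> H \<and>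
      0 \<le> E g \<and> E g \<le> G g \<and> G g \<le> Z g \<and> Z g \<le> H \<and> H * (lev g + 1) + H \<le> T"
    and L_src: "i \<in> J \<Longrightarrow> L (src i) \<le> L i" and L_snk: "i \<in> J \<Longrightarrow> L (snk i) \<le> L i"
    and A_ge: "i \<in> J \<Longrightarrow> L i + G (snk i) + Y (snk i) \<le> A i"
    and Y_ge: "i \<in> J \<Longrightarrow> Y i + A (src i) \<le> Y (src i)"
    and G_ge: "i \<in> J \<Longrightarrow> Z (src i) + A (src i) \<le> G i"
    and Z_ge: "i \<in> J \<Longrightarrow> Z i + L i + G (snk i) \<le> Z (snk i)"
    and E_ge: "i \<in> J \<Longrightarrow> E (src i) + A (src i) \<le> E i"
begin

definition base :: "'i \<Rightarrow> real" where
  "base g = H * (lev g + 1)"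

definition V :: "'i vertex set" where
  "V = Centre ` I \<union> PortP ` I \<union> PortA ` I \<union> PortB ` I \<union> Source ` J \<union> Sink ` J"

definition Ed :: "'i edge set" where
  "Ed = SpokeP ` I \<union> SpokeA ` I \<union> SpokeB ` I \<union> SourceE ` J \<union> LinkA ` J \<union> LinkB ` J \<union> SinkE ` J"

primrec joins :: "'i edge \<Rightarrow> 'i vertex \<times> 'i vertex" where
  "joins (SpokeP g) = (PortP g, Centre g)"
| "joins (SpokeA g) = (PortA g, Centre g)"
| "joins (SpokeB g) = (PortB g, Centre g)"
| "joins (SourceE i) = (Source i, PortP (src i))"
| "joins (LinkA i) = (PortA (src i), PortA i)"
| "joins (LinkB i) = (PortB i, PortB (snk i))"
| "joins (SinkE i) = (PortP (snk i), Sink i)"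

primrec cap :: "'i edge \<Rightarrow> real" where
  "cap (SpokeP g) = c / L g"
| "cap (SpokeA g) = c / L g"
| "cap (SpokeB g) = c / L g"
| "cap (SourceE i) = c / L i"
| "cap (LinkA i) = c / L i"
| "cap (LinkB i) = c / L i"
| "cap (SinkE i) = c / L i"

primrec trans :: "'i edge \<Rightarrow> real" where
  "trans (SpokeP g) = 0"
| "trans (SpokeA g) = 0"
| "trans (SpokeB g) = 0"
| "trans (SourceE i) = base (src i) + A (src i)"
| "trans (LinkA i) = H - A (src i)"
| "trans (LinkB i) = H - L i - G (snk i)"
| "trans (SinkE i) = T - base (snk i) + G (snk i)"

primrec bal :: "'i vertex \<Rightarrow> real" where
  "bal (Centre g) = 0"
| "bal (PortP g) = 0"
| "bal (PortA g) = 0"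
| "bal (PortB g) = 0"
| "bal (Source i) = c"
| "bal (Sink i) = - c"

lemma J_in_I: "i \<in> J \<Longrightarrow> i \<in> I"
  using J_subset by auto

lemma finite_J: "finite J"
  using finite_I J_subset by (rule rev_finite_subset)

lemma base_src: "i \<in> J \<Longrightarrow> base i = base (src i) + H"
  by (simp add: base_def lev_src algebra_simps)

lemma base_snk: "i \<in> J \<Longrightarrow> base (snk i) = base i + H"
  by (simp add: base_def lev_snk algebra_simps)

lemma H_le_base: "g \<in> I \<Longrightarrow> H \<le> base g"
  using gadget_bounds[of g] by (auto simp: base_def algebra_simps intro: mult_nonneg_nonneg)

lemma bounds:
  assumes "g \<in> I"
  shows "0 < L g" "L g \<le> A g" "A g \<le> Y g" "Y g \<le> H" "0 \<le> E g" "E g \<le> G g" "G g \<le> Z g" "Z g \<le> H"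
    "base g + H \<le> T" "H \<le> base g"
  using gadget_bounds[OF assms] H_le_base[OF assms] by (auto simp: base_def)

lemma cap_nonneg: "e \<in> Ed \<Longrightarrow> 0 \<le> cap e"
  unfolding Ed_def using c_pos bounds(1) J_in_I by (fastforce intro: divide_nonneg_pos)

lemma trans_nonneg: "e \<in> Ed \<Longrightarrow> 0 \<le> trans e"
  unfolding Ed_def
proof (elim UnE imageE)
  fix i assume "e = SourceE i" "i \<in> J"
  then show "0 \<le> trans e" using bounds[OF src_in, of i] by simp
next
  fix i assume "e = LinkA i" "i \<in> J"
  then show "0 \<le> trans e" using bounds[OF src_in, of i] by simp
next
  fix i assume "e = LinkB i" "i \<in> J"
  then show "0 \<le> trans e" using bounds[OF J_in_I, of i] bounds[OF snk_in, of i] A_ge[of i] by simp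
next
  fix i assume "e = SinkE i" "i \<in> J"
  then show "0 \<le> trans e" using bounds[OF snk_in, of i] by simp
qed auto

end

locale oriented_gadget_network = gadget_network +
  fixes tail_of head_of :: "'a edge \<Rightarrow> 'a vertex"
  assumes orientation: "e \<in> Ed \<Longrightarrow> (tail_of e, head_of e) = joins e \<or> (head_of e, tail_of e) = joins e"
begin

definition S_type :: "'a \<Rightarrow> bool" where
  "S_type g \<longleftrightarrow> head_of (SpokeP g) = Centre g \<and> head_of (SpokeA g) \<noteq> Centre g"

definition P_type :: "'a \<Rightarrow> bool" where
  "P_type g \<longleftrightarrow> head_of (SpokeA g) = Centre g \<and> head_of (SpokeB g) \<noteq> Centre g"

definition D_type :: "'a \<Rightarrow> bool" where
  "D_type g \<longleftrightarrow> head_of (SpokeB g) = Centre g \<and> head_of (SpokeP g) \<noteq> Centre g"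

lemma spoke_cases:
  assumes "g \<in> I"
  shows "(tail_of (SpokeP g) = PortP g \<and> head_of (SpokeP g) = Centre g) \<or> (tail_of (SpokeP g) = Centre g \<and> head_of (SpokeP g) = PortP g)"
    "(tail_of (SpokeA g) = PortA g \<and> head_of (SpokeA g) = Centre g) \<or> (tail_of (SpokeA g) = Centre g \<and> head_of (SpokeA g) = PortA g)"
    "(tail_of (SpokeB g) = PortB g \<and> head_of (SpokeB g) = Centre g) \<or> (tail_of (SpokeB g) = Centre g \<and> head_of (SpokeB g) = PortB g)"
  using assms orientation[of "SpokeP g"] orientation[of "SpokeA g"] orientation[of "SpokeB g"]
  by (auto simp: Ed_def)

lemma link_cases:
  assumes "i \<in> J"
  shows "(tail_of (SourceE i) = Source i \<and> head_of (SourceE i) = PortP (src i)) \<or> (tail_of (SourceE i) = PortP (src i) \<and> head_of (SourceE i) = Source i)"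
    "(tail_of (LinkA i) = PortA (src i) \<and> head_of (LinkA i) = PortA i) \<or> (tail_of (LinkA i) = PortA i \<and> head_of (LinkA i) = PortA (src i))"
    "(tail_of (LinkB i) = PortB i \<and> head_of (LinkB i) = PortB (snk i)) \<or> (tail_of (LinkB i) = PortB (snk i) \<and> head_of (LinkB i) = PortB i)"
    "(tail_of (SinkE i) = PortP (snk i) \<and> head_of (SinkE i) = Sink i) \<or> (tail_of (SinkE i) = Sink i \<and> head_of (SinkE i) = PortP (snk i))"
  using assms orientation[of "SourceE i"] orientation[of "LinkA i"] orientation[of "LinkB i"] orientation[of "SinkE i"]
  by (auto simp: Ed_def)

definition uncrossed :: "('a vertex \<Rightarrow> real) \<Rightarrow> 'a edge \<Rightarrow> bool" where
  "uncrossed \<alpha> e \<longleftrightarrow> \<alpha> (head_of e) \<le> \<alpha> (tail_of e) + trans e"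

text \<open>A cut over time assigns to each vertex the time from which on it belongs to the source side.\<close>

definition supply_cut :: "'a vertex \<Rightarrow> real" where
  "supply_cut v = (case v of
      Centre g \<Rightarrow> base g + (if head_of (SpokeP g) = Centre g \<and> \<not> S_type g then A g else Y g)
    | PortP g \<Rightarrow> if S_type g then T else if head_of (SpokeP g) = Centre g then base g + A g else base g - G g
    | PortA g \<Rightarrow> base g + Y g
    | PortB g \<Rightarrow> base g + (if head_of (SpokeB g) = Centre g then Y g else A g)
    | Source i \<Rightarrow> if S_type (src i) then T else 0
    | Sink i \<Rightarrow> T)"

definition demand_cut :: "'a vertex \<Rightarrow> real" where
  "demand_cut v = (case v of
      Centre g \<Rightarrow> base g - (if head_of (SpokeP g) \<noteq> Centre g \<and> \<not> D_type g then G g else Z g)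
    | PortP g \<Rightarrow> if D_type g then 0 else if head_of (SpokeP g) = Centre g then base g + A g else base g - G g
    | PortA g \<Rightarrow> base g - (if head_of (SpokeA g) = Centre g then G g else Z g)
    | PortB g \<Rightarrow> base g - Z g
    | Source i \<Rightarrow> 0
    | Sink i \<Rightarrow> if D_type (snk i) then 0 else T)"

definition pass_cut :: "'a vertex \<Rightarrow> real" where
  "pass_cut v = (case v of
      Centre g \<Rightarrow> if head_of (SpokeA g) = Centre g then base g - E g else base g + A g
    | PortP g \<Rightarrow> if head_of (SpokeP g) = Centre g then base g + A g else base g - G g
    | PortA g \<Rightarrow> base g - E g
    | PortB g \<Rightarrow> base g + A g
    | Source i \<Rightarrow> 0
    | Sink i \<Rightarrow> T)"

lemma cut_range:
  assumes "v \<in> V"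
  shows "0 \<le> supply_cut v \<and> supply_cut v \<le> T" "0 \<le> demand_cut v \<and> demand_cut v \<le> T" "0 \<le> pass_cut v \<and> pass_cut v \<le> T"
proof -
  have T: "0 \<le> T" if "g \<in> I" for g using bounds[OF that] by linarith
  have "(0 \<le> supply_cut v \<and> supply_cut v \<le> T) \<and> (0 \<le> demand_cut v \<and> demand_cut v \<le> T) \<and> (0 \<le> pass_cut v \<and> pass_cut v \<le> T)"
    using assms unfolding V_def
  proof (elim UnE imageE)
    fix i assume "v = Source i" "i \<in> J"
    then show ?thesis using T[OF J_in_I] by (auto simp: supply_cut_def demand_cut_def pass_cut_def)
  next
    fix i assume "v = Sink i" "i \<in> J"
    then show ?thesis using T[OF J_in_I] by (auto simp: supply_cut_def demand_cut_def pass_cut_def)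
  next
    fix g assume "v = Centre g" "g \<in> I"
    then show ?thesis using bounds[of g] by (auto simp: supply_cut_def demand_cut_def pass_cut_def)
  next
    fix g assume "v = PortP g" "g \<in> I"
    then show ?thesis using bounds[of g] by (auto simp: supply_cut_def demand_cut_def pass_cut_def)
  next
    fix g assume "v = PortA g" "g \<in> I"
    then show ?thesis using bounds[of g] by (auto simp: supply_cut_def demand_cut_def pass_cut_def)
  next
    fix g assume "v = PortB g" "g \<in> I"
    then show ?thesis using bounds[of g] by (auto simp: supply_cut_def demand_cut_def pass_cut_def)
  qed
  then show "0 \<le> supply_cut v \<and> supply_cut v \<le> T" "0 \<le> demand_cut v \<and> demand_cut v \<le> T" "0 \<le> pass_cut v \<and> pass_cut v \<le> T"
    by blast+
qed

lemma uncrossed_links: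
  assumes "i \<in> J" "e \<in> {SourceE i, LinkA i, LinkB i, SinkE i}"
  shows "uncrossed supply_cut e" "uncrossed demand_cut e" "uncrossed pass_cut e"
proof -
  note b = bounds[OF J_in_I[OF assms(1)]] bounds[OF src_in[OF assms(1)]] bounds[OF snk_in[OF assms(1)]]
    base_src[OF assms(1)] base_snk[OF assms(1)] A_ge[OF assms(1)] Y_ge[OF assms(1)] G_ge[OF assms(1)]
    Z_ge[OF assms(1)] E_ge[OF assms(1)]
  have S: "uncrossed supply_cut (SourceE i)" "uncrossed demand_cut (SourceE i)" "uncrossed pass_cut (SourceE i)"
    using link_cases(1)[OF assms(1)] b by (auto simp: uncrossed_def supply_cut_def demand_cut_def pass_cut_def)
  have A: "uncrossed supply_cut (LinkA i)" "uncrossed demand_cut (LinkA i)" "uncrossed pass_cut (LinkA i)"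
    using link_cases(2)[OF assms(1)] b by (auto simp: uncrossed_def supply_cut_def demand_cut_def pass_cut_def)
  have B: "uncrossed supply_cut (LinkB i)" "uncrossed demand_cut (LinkB i)" "uncrossed pass_cut (LinkB i)"
    using link_cases(3)[OF assms(1)] b by (auto simp: uncrossed_def supply_cut_def demand_cut_def pass_cut_def)
  have D: "uncrossed supply_cut (SinkE i)" "uncrossed demand_cut (SinkE i)" "uncrossed pass_cut (SinkE i)"
    using link_cases(4)[OF assms(1)] b by (auto simp: uncrossed_def supply_cut_def demand_cut_def pass_cut_def)
  show "uncrossed supply_cut e" "uncrossed demand_cut e" "uncrossed pass_cut e"
    using assms(2) S A B D by auto
qed

lemma uncrossed_spokes:
  assumes "g \<in> I" "e \<in> {SpokeP g, SpokeA g, SpokeB g}"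
  shows "uncrossed supply_cut e" "uncrossed demand_cut e"
    "uncrossed pass_cut e \<or> e = SpokeB g \<and> P_type g"
proof -
  note b = bounds[OF assms(1)] and s = spoke_cases[OF assms(1)]
  show "uncrossed supply_cut e"
    using s b assms(2) by (auto simp: uncrossed_def supply_cut_def S_type_def)
  show "uncrossed demand_cut e"
    using s b assms(2) by (auto simp: uncrossed_def demand_cut_def D_type_def)
  show "uncrossed pass_cut e \<or> e = SpokeB g \<and> P_type g"
    using s b assms(2) by (auto simp: uncrossed_def pass_cut_def P_type_def)
qed

end

lemma sum_le_if_unique_nonzero:
  fixes g :: "'b \<Rightarrow> real"
  assumes "finite S" "0 \<le> C" "\<And>x. x \<in> S \<Longrightarrow> g x \<le> C"
    and "\<And>x y. x \<in> S \<Longrightarrow> y \<in> S \<Longrightarrow> g x \<noteq> 0 \<Longrightarrow> g y \<noteq> 0 \<Longrightarrow> x = y"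
  shows "sum g S \<le> C"
proof (cases "\<exists>x\<in>S. g x \<noteq> 0")
  case True
  then obtain x where x: "x \<in> S" "g x \<noteq> 0" by blast
  have "sum g S = sum g {x}"
    using assms x by (intro sum.mono_neutral_right) auto
  then show ?thesis using assms(3)[OF x(1)] by simp
next
  case False
  then show ?thesis using assms(2) by simp
qed

lemma pulse_total_bounds:
  assumes "0 < l" "0 < c"
  shows "0 \<le> pulse_total l (c / l) y" "pulse_total l (c / l) y \<le> c" "pulse_total l (c / l) l = c"
proof -
  have "c / l * min (max 0 y) l \<le> c / l * l"
    using assms by (intro mult_left_mono) auto
  then show "pulse_total l (c / l) y \<le> c"
    using assms by (simp add: pulse_total_def)
qed (use assms in \<open>auto simp: pulse_total_def\<close>)

context gadget_network
begin

definition network :: "(nat, nat) undirected_network" where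
  "network = \<lparr>vertices = to_nat ` V, edges = to_nat ` Ed,
     ends = (\<lambda>e. {to_nat (fst (joins (from_nat e))), to_nat (snd (joins (from_nat e)))}),
     capacity = (\<lambda>e. cap (from_nat e)), transit = (\<lambda>e. trans (from_nat e)),
     balance = (\<lambda>v. bal (from_nat v)), horizon = T\<rparr>"

lemma finite_V: "finite V" and finite_Ed: "finite Ed"
  by (simp_all add: V_def Ed_def finite_I finite_J)

lemma joins_in_V: "e \<in> Ed \<Longrightarrow> fst (joins e) \<in> V \<and> snd (joins e) \<in> V"
  using J_in_I src_in snk_in by (auto simp: Ed_def V_def)

lemma src_neq: "i \<in> J \<Longrightarrow> src i \<noteq> i" and snk_neq: "i \<in> J \<Longrightarrow> snk i \<noteq> i"
  using lev_src lev_snk by (metis n_not_Suc_n)+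

lemma joins_distinct: "e \<in> Ed \<Longrightarrow> fst (joins e) \<noteq> snd (joins e)"
  using src_neq snk_neq by (auto simp: Ed_def) metis

lemma sum_V:
  fixes h :: "'i vertex \<Rightarrow> real"
  assumes "\<And>g. h (Centre g) = 0" "\<And>g. h (PortP g) = 0" "\<And>g. h (PortA g) = 0" "\<And>g. h (PortB g) = 0"
  shows "(\<Sum>v\<in>V. h v) = (\<Sum>i\<in>J. h (Source i)) + (\<Sum>i\<in>J. h (Sink i))"
proof -
  have "(\<Sum>v\<in>V. h v) = (\<Sum>v\<in>Source ` J \<union> Sink ` J. h v)"
    using finite_V assms by (intro sum.mono_neutral_right) (auto simp: V_def)
  also have "\<dots> = (\<Sum>v\<in>Source ` J. h v) + (\<Sum>v\<in>Sink ` J. h v)"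
    using finite_J by (intro sum.union_disjoint) auto
  also have "\<dots> = (\<Sum>i\<in>J. h (Source i)) + (\<Sum>i\<in>J. h (Sink i))"
    by (simp add: sum.reindex inj_on_def)
  finally show ?thesis .
qed

lemma sum_to_nat_V: "(\<Sum>v\<in>to_nat ` V. h (from_nat v :: 'i vertex)) = (\<Sum>v\<in>V. h v :: real)"
  by (simp add: sum.reindex)

lemma network_wf:
  assumes "J \<noteq> {}"
  shows "undirected_network_over_time network"
proof -
  obtain i where i: "i \<in> J" using assms by blast
  have "0 \<le> T" using bounds[OF J_in_I[OF i]] by linarith
  moreover have "(\<Sum>v\<in>to_nat ` V. bal (from_nat v)) = 0"
    unfolding sum_to_nat_V by (simp add: sum_V)
  moreover have "card {to_nat (fst (joins e)), to_nat (snd (joins e))} = 2" if "e \<in> Ed" for e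
    using joins_distinct[OF that] by simp
  ultimately show ?thesis
    using joins_in_V cap_nonneg trans_nonneg finite_V finite_Ed
    by (auto simp: undirected_network_over_time_def network_def)
qed

lemma total_supply_network: "total_supply network = c * card J"
proof -
  have "total_supply network = (\<Sum>v\<in>to_nat ` V. if 0 < bal (from_nat v) then bal (from_nat v) else 0)"
    unfolding total_supply_def network_def using finite_V by (simp add: sum.inter_filter)
  also have "\<dots> = (\<Sum>v\<in>V. if 0 < bal v then bal v else 0)"
    by (rule sum_to_nat_V)
  also have "\<dots> = c * card J"
    using c_pos by (simp add: sum_V)
  finally show ?thesis .
qed

lemma orientation_cut_bound:
  assumes D: "is_orientation network D" and f: "directed_flow_over_time D f"
    and \<alpha>: "\<And>v. v \<in> V \<Longrightarrow> 0 \<le> \<alpha> v \<and> \<alpha> v \<le> T"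
    and tail_of: "\<And>e. tail_of e = from_nat (tail (graph D) (to_nat e))"
    and head_of: "\<And>e. head_of e = from_nat (head (graph D) (to_nat e))"
  shows "flow_value (graph D) (dtransit D) (dbalance D) (dhorizon D) f
    \<le> (\<Sum>e\<in>Ed. cap e * max 0 (\<alpha> (head_of e) - trans e - \<alpha> (tail_of e)))
      + c * card {i \<in> J. 0 < \<alpha> (Source i)} + c * card {i \<in> J. \<alpha> (Sink i) < T}"
proof -
  have D': "verts (graph D) = to_nat ` V" "arcs (graph D) = to_nat ` Ed"
    "dcapacity D = (\<lambda>e. cap (from_nat e))" "dtransit D = (\<lambda>e. trans (from_nat e))"
    "dbalance D = (\<lambda>v. bal (from_nat v))" "dhorizon D = T"
    using D by (auto simp: is_orientation_def network_def)
  have ends: "{tail (graph D) (to_nat e), head (graph D) (to_nat e)} = {to_nat (fst (joins e)), to_nat (snd (joins e))}"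
    if "e \<in> Ed" for e
    using D that unfolding is_orientation_def network_def by auto
  interpret fin_digraph "graph D"
  proof
    fix a assume "a \<in> arcs (graph D)"
    then obtain e where e: "e \<in> Ed" "a = to_nat e" using D' by auto
    have "{tail (graph D) a, head (graph D) a} \<subseteq> to_nat ` V"
      unfolding e(2) ends[OF e(1)] using joins_in_V[OF e(1)] by auto
    then show "tail (graph D) a \<in> verts (graph D)" "head (graph D) a \<in> verts (graph D)"
      using D' by auto
  qed (use D' finite_V finite_Ed in auto)
  have "flow_value (graph D) (dtransit D) (dbalance D) (dhorizon D) f
    \<le> (\<Sum>a\<in>arcs (graph D). dcapacity D a * max 0 (\<alpha> (from_nat (head (graph D) a)) - dtransit D a
          - \<alpha> (from_nat (tail (graph D) a))))
      + (\<Sum>v | v \<in> verts (graph D) \<and> 0 < dbalance D v \<and> 0 < \<alpha> (from_nat v). dbalance D v)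
      + (\<Sum>v | v \<in> verts (graph D) \<and> dbalance D v < 0 \<and> \<alpha> (from_nat v) < dhorizon D. - dbalance D v)"
    by (rule flow_value_le_cut)
       (use f \<alpha> cap_nonneg trans_nonneg in \<open>auto simp: directed_flow_over_time_def D'\<close>)
  also have "(\<Sum>a\<in>arcs (graph D). dcapacity D a * max 0 (\<alpha> (from_nat (head (graph D) a)) - dtransit D a
          - \<alpha> (from_nat (tail (graph D) a))))
      = (\<Sum>e\<in>Ed. cap e * max 0 (\<alpha> (head_of e) - trans e - \<alpha> (tail_of e)))"
    by (simp add: D' sum.reindex tail_of head_of)
  also have "(\<Sum>v | v \<in> verts (graph D) \<and> 0 < dbalance D v \<and> 0 < \<alpha> (from_nat v). dbalance D v)
      = (\<Sum>v\<in>V. if 0 < bal v \<and> 0 < \<alpha> v then bal v else 0)"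
    using finite_V unfolding D' by (simp add: sum.inter_filter sum.reindex cong: if_cong)
  also have "\<dots> = c * card {i \<in> J. 0 < \<alpha> (Source i)}"
    using c_pos finite_J by (simp add: sum_V sum.inter_filter[symmetric])
  also have "(\<Sum>v | v \<in> verts (graph D) \<and> dbalance D v < 0 \<and> \<alpha> (from_nat v) < dhorizon D. - dbalance D v)
      = (\<Sum>v\<in>V. if bal v < 0 \<and> \<alpha> v < T then - bal v else 0)"
    using finite_V unfolding D' by (simp add: sum.inter_filter sum.reindex cong: if_cong)
  also have "\<dots> = c * card {i \<in> J. \<alpha> (Sink i) < T}"
    using c_pos finite_J by (simp add: sum_V sum.inter_filter[symmetric])
  finally show ?thesis .
qed

lemma orientation_flow_value:
  assumes D: "is_orientation network D" and f: "directed_flow_over_time D f"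
    and \<rho>: "1 \<le> \<rho>" "\<And>g. g \<in> I \<Longrightarrow> A g + E g \<le> \<rho> * L g"
  shows "3 * flow_value (graph D) (dtransit D) (dbalance D) (dhorizon D) f \<le> \<rho> * c * card I"
proof -
  let ?F = "flow_value (graph D) (dtransit D) (dbalance D) (dhorizon D) f"
  define tail_of :: "'i edge \<Rightarrow> 'i vertex" where "tail_of e = from_nat (tail (graph D) (to_nat e))" for e
  define head_of :: "'i edge \<Rightarrow> 'i vertex" where "head_of e = from_nat (head (graph D) (to_nat e))" for e
  interpret oriented_gadget_network I J src snk lev L A G Y Z E H c T tail_of head_of
  proof unfold_locales
    fix e assume "e \<in> Ed"
    then have "{tail (graph D) (to_nat e), head (graph D) (to_nat e)} = {to_nat (fst (joins e)), to_nat (snd (joins e))}"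
      using D unfolding is_orientation_def network_def by auto
    then show "(tail_of e, head_of e) = joins e \<or> (head_of e, tail_of e) = joins e"
      unfolding tail_of_def head_of_def by (auto simp: doubleton_eq_iff)
  qed
  note bound = orientation_cut_bound[OF D f _ tail_of_def head_of_def]
  have no_cost: "cap e * max 0 (\<alpha> (head_of e) - trans e - \<alpha> (tail_of e)) = 0" if "uncrossed \<alpha> e" for \<alpha> e
    using that by (simp add: uncrossed_def)
  have Ed_cases: "(\<exists>g\<in>I. e \<in> {SpokeP g, SpokeA g, SpokeB g}) \<or> (\<exists>i\<in>J. e \<in> {SourceE i, LinkA i, LinkB i, SinkE i})"
    if "e \<in> Ed" for e using that by (auto simp: Ed_def)
  have card_J: "card {i \<in> J. P (h i)} \<le> card {g \<in> I. P g}" if "inj_on h J" "h ` J \<subseteq> I" for h P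
  proof -
    have "card {i \<in> J. P (h i)} = card (h ` {i \<in> J. P (h i)})"
      using that(1) by (intro card_image[symmetric]) (auto intro: inj_on_subset)
    also have "\<dots> \<le> card {g \<in> I. P g}"
      using that(2) finite_I by (intro card_mono) auto
    finally show ?thesis .
  qed
  have S: "?F \<le> c * card {g \<in> I. S_type g}"
  proof -
    have zero: "(\<Sum>e\<in>Ed. cap e * max 0 (supply_cut (head_of e) - trans e - supply_cut (tail_of e))) = 0"
      by (intro sum.neutral ballI no_cost) (use Ed_cases uncrossed_spokes(1) uncrossed_links(1) in blast)
    have none: "{i \<in> J. supply_cut (Sink i) < T} = {}"
      by (auto simp: supply_cut_def)
    have "card {i \<in> J. 0 < supply_cut (Source i)} \<le> card {i \<in> J. S_type (src i)}"
      using finite_J by (intro card_mono) (auto simp: supply_cut_def split: if_splits)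
    also have "\<dots> \<le> card {g \<in> I. S_type g}"
      using inj_src src_in by (intro card_J[where h = src and P = S_type]) auto
    finally have le: "card {i \<in> J. 0 < supply_cut (Source i)} \<le> card {g \<in> I. S_type g}" .
    have "?F \<le> c * card {i \<in> J. 0 < supply_cut (Source i)}"
      using bound[of supply_cut, OF cut_range(1)] unfolding zero none by simp
    also have "\<dots> \<le> c * card {g \<in> I. S_type g}"
      using le c_pos by (intro mult_left_mono) auto
    finally show ?thesis .
  qed
  have D: "?F \<le> c * card {g \<in> I. D_type g}"
  proof -
    have zero: "(\<Sum>e\<in>Ed. cap e * max 0 (demand_cut (head_of e) - trans e - demand_cut (tail_of e))) = 0"
      by (intro sum.neutral ballI no_cost) (use Ed_cases uncrossed_spokes(2) uncrossed_links(2) in blast)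
    have none: "{i \<in> J. 0 < demand_cut (Source i)} = {}"
      by (auto simp: demand_cut_def)
    have "card {i \<in> J. demand_cut (Sink i) < T} \<le> card {i \<in> J. D_type (snk i)}"
      using finite_J by (intro card_mono) (auto simp: demand_cut_def split: if_splits)
    also have "\<dots> \<le> card {g \<in> I. D_type g}"
      using inj_snk snk_in by (intro card_J[where h = snk and P = D_type]) auto
    finally have le: "card {i \<in> J. demand_cut (Sink i) < T} \<le> card {g \<in> I. D_type g}" .
    have "?F \<le> c * card {i \<in> J. demand_cut (Sink i) < T}"
      using bound[of demand_cut, OF cut_range(2)] unfolding zero none by simp
    also have "\<dots> \<le> c * card {g \<in> I. D_type g}"
      using le c_pos by (intro mult_left_mono) auto
    finally show ?thesis .
  qed
  have P: "?F \<le> \<rho> * c * card {g \<in> I. P_type g}"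
  proof -
    let ?cost = "\<lambda>e. cap e * max 0 (pass_cut (head_of e) - trans e - pass_cut (tail_of e))"
    have "uncrossed pass_cut e" if "e \<in> Ed - SpokeB ` {g \<in> I. P_type g}" for e
      using that Ed_cases[of e] uncrossed_spokes(3) uncrossed_links(3) by blast
    then have "(\<Sum>e\<in>Ed. ?cost e) = (\<Sum>e\<in>SpokeB ` {g \<in> I. P_type g}. ?cost e)"
      by (intro sum.mono_neutral_right ballI no_cost finite_Ed) (auto simp: Ed_def)
    also have "\<dots> = (\<Sum>g | g \<in> I \<and> P_type g. ?cost (SpokeB g))"
      by (simp add: sum.reindex inj_on_def)
    also have "\<dots> \<le> (\<Sum>g | g \<in> I \<and> P_type g. \<rho> * c)"
    proof (rule sum_mono)
      fix g assume "g \<in> {g \<in> I. P_type g}"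
      then have g: "g \<in> I" "P_type g" by auto
      have "?cost (SpokeB g) = c / L g * (A g + E g)"
        using g spoke_cases[OF g(1)] bounds[OF g(1)] by (auto simp: P_type_def pass_cut_def)
      also have "\<dots> \<le> c / L g * (\<rho> * L g)"
        using \<rho>(2)[OF g(1)] c_pos bounds(1)[OF g(1)] by (intro mult_left_mono) auto
      also have "\<dots> = \<rho> * c" using bounds(1)[OF g(1)] by simp
      finally show "?cost (SpokeB g) \<le> \<rho> * c" .
    qed
    also have "\<dots> = \<rho> * c * card {g \<in> I. P_type g}" by simp
    finally have "(\<Sum>e\<in>Ed. ?cost e) \<le> \<rho> * c * card {g \<in> I. P_type g}" .
    moreover have none: "{i \<in> J. 0 < pass_cut (Source i)} = {}" "{i \<in> J. pass_cut (Sink i) < T} = {}"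
      by (auto simp: pass_cut_def)
    have "?F \<le> (\<Sum>e\<in>Ed. ?cost e)"
      using bound[of pass_cut, OF cut_range(3)] unfolding none by simp
    ultimately show ?thesis by linarith
  qed
  have "card {g \<in> I. S_type g} + card {g \<in> I. P_type g} + card {g \<in> I. D_type g}
      = card ({g \<in> I. S_type g} \<union> {g \<in> I. P_type g} \<union> {g \<in> I. D_type g})"
    using finite_I by (subst card_Un_disjoint | force simp: S_type_def P_type_def D_type_def)+
  also have "\<dots> \<le> card I"
    using finite_I by (intro card_mono) auto
  finally have count: "real (card {g \<in> I. S_type g}) + card {g \<in> I. P_type g} + card {g \<in> I. D_type g} \<le> card I"
    by linarith
  have mono: "c * real m \<le> \<rho> * c * real m" for m
    using \<rho>(1) c_pos by (intro mult_right_mono) auto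
  have "3 * ?F \<le> \<rho> * c * (real (card {g \<in> I. S_type g}) + card {g \<in> I. P_type g} + card {g \<in> I. D_type g})"
    using S D P mono[of "card {g \<in> I. S_type g}"] mono[of "card {g \<in> I. D_type g}"]
    unfolding distrib_left by linarith
  also have "\<dots> \<le> \<rho> * c * card I"
    using count \<rho>(1) c_pos by (intro mult_left_mono) auto
  finally show ?thesis .
qed

end

lemma less_10_cases:
  fixes m :: nat
  shows "m < 10 \<longleftrightarrow> m = 0 \<or> m = 1 \<or> m = 2 \<or> m = 3 \<or> m = 4 \<or> m = 5 \<or> m = 6 \<or> m = 7 \<or> m = 8 \<or> m = 9"
  by presburger

context gadget_network
begin

definition walk_edge :: "'i \<Rightarrow> nat \<Rightarrow> 'i edge" where
  "walk_edge i m = [SourceE i, SpokeP (src i), SpokeA (src i), LinkA i, SpokeA i, SpokeB i, LinkB i,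
     SpokeB (snk i), SpokeP (snk i), SinkE i] ! m"

definition walk_vertex :: "'i \<Rightarrow> nat \<Rightarrow> 'i vertex" where
  "walk_vertex i m = [Source i, PortP (src i), Centre (src i), PortA (src i), PortA i, Centre i, PortB i,
     PortB (snk i), Centre (snk i), PortP (snk i), Sink i] ! m"

definition walk_time :: "'i \<Rightarrow> nat \<Rightarrow> real" where
  "walk_time i m = [0, base (src i) + A (src i), base (src i) + A (src i), base (src i) + A (src i),
     base i, base i, base i, base (snk i) - G (snk i) - L i, base (snk i) - G (snk i) - L i,
     base (snk i) - G (snk i) - L i, T - L i] ! m"

definition walk_arc :: "'i \<Rightarrow> nat \<Rightarrow> nat \<times> nat \<times> nat" where
  "walk_arc i m = (to_nat (walk_edge i m), to_nat (walk_vertex i m), to_nat (walk_vertex i (Suc m)))"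

lemmas walk_defs = walk_edge_def walk_vertex_def walk_time_def

lemma walk_edge_in_Ed: "i \<in> J \<Longrightarrow> m < 10 \<Longrightarrow> walk_edge i m \<in> Ed"
  using J_in_I src_in snk_in unfolding less_10_cases
  by (elim disjE) (simp_all add: walk_edge_def Ed_def)

lemma walk_edge_joins:
  "m < 10 \<Longrightarrow> joins (walk_edge i m) = (walk_vertex i m, walk_vertex i (Suc m))
    \<or> joins (walk_edge i m) = (walk_vertex i (Suc m), walk_vertex i m)"
  unfolding less_10_cases by (elim disjE) (simp_all add: walk_defs)

lemma walk_time_Suc: "i \<in> J \<Longrightarrow> m < 10 \<Longrightarrow> walk_time i (Suc m) = walk_time i m + trans (walk_edge i m)"
  using base_src base_snk unfolding less_10_cases by (elim disjE) (simp_all add: walk_defs)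

sublocale walk_family "bidirection network" "\<lambda>(e, _). transit network e" T J 10
  walk_arc "\<lambda>i m. to_nat (walk_vertex i m)" walk_time L "\<lambda>i. c / L i"
proof
  fix a assume "a \<in> arcs (bidirection network)"
  then show "tail (bidirection network) a \<in> verts (bidirection network)"
    "head (bidirection network) a \<in> verts (bidirection network)"
    using joins_in_V by (auto simp: bidirection_def network_def doubleton_eq_iff)
next
  show "finite (verts (bidirection network))"
    using finite_V by (simp add: bidirection_def network_def)
next
  have "arcs (bidirection network) \<subseteq> to_nat ` Ed \<times> to_nat ` V \<times> to_nat ` V"
    using joins_in_V by (auto simp: bidirection_def network_def doubleton_eq_iff)
  then show "finite (arcs (bidirection network))"
    by (rule finite_subset) (simp add: finite_V finite_Ed)
next
  fix i m assume "i \<in> J" "m < (10 :: nat)"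
  then show "walk_arc i m \<in> arcs (bidirection network)"
    using walk_edge_in_Ed[of i m] walk_edge_joins[of m i]
    by (auto simp: bidirection_def network_def walk_arc_def)
next
  fix a assume "a \<in> arcs (bidirection network)"
  then show "0 \<le> (case a of (e, _) \<Rightarrow> transit network e)"
    using trans_nonneg by (auto simp: bidirection_def network_def)
qed (use c_pos bounds(1)[OF J_in_I] walk_time_Suc finite_J in
      \<open>auto simp: bidirection_def network_def walk_arc_def walk_time_def[of _ 0] walk_time_def[of _ 10] less_imp_le\<close>)

lemma active_walk_unique:
  assumes i: "i \<in> J" "m < 10" "walk_time i m \<le> \<theta>" "\<theta> < walk_time i m + L i"
    and j: "j \<in> J" "n < 10" "walk_time j n \<le> \<theta>" "\<theta> < walk_time j n + L j"
    and eq: "walk_edge i m = walk_edge j n"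
  shows "i = j \<and> m = n"
proof -
  note b = bounds[OF J_in_I[OF i(1)]] bounds[OF src_in[OF i(1)]] bounds[OF snk_in[OF i(1)]]
     bounds[OF J_in_I[OF j(1)]] bounds[OF src_in[OF j(1)]] bounds[OF snk_in[OF j(1)]]
  consider "i = j \<and> m = n" | "src i = src j \<and> m = n" | "snk i = snk j \<and> m = n"
    | "m = 1 \<and> n = 8 \<and> src i = snk j" | "m = 8 \<and> n = 1 \<and> snk i = src j"
    | "m = 2 \<and> n = 4 \<and> src i = j" | "m = 4 \<and> n = 2 \<and> i = src j"
    | "m = 5 \<and> n = 7 \<and> i = snk j" | "m = 7 \<and> n = 5 \<and> snk i = j"
    using i(2) j(2) eq unfolding less_10_cases by (elim disjE) (simp_all add: walk_edge_def)
  then show ?thesis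
  proof cases
    case 2
    then show ?thesis using inj_onD[OF inj_src _ i(1) j(1)] by simp
  next
    case 3
    then show ?thesis using inj_onD[OF inj_snk _ i(1) j(1)] by simp
  next
    case 4
    then have "base (snk j) + A (snk j) \<le> \<theta>" "\<theta> < base (snk j) - G (snk j)"
      using i(3) j(4) by (simp_all add: walk_time_def)
    then show ?thesis using b by linarith
  next
    case 5
    then have "base (snk i) + A (snk i) \<le> \<theta>" "\<theta> < base (snk i) - G (snk i)"
      using i(4) j(3) by (simp_all add: walk_time_def)
    then show ?thesis using b by linarith
  next
    case 6
    then have "base j + A j \<le> \<theta>" "\<theta> < base j + L j"
      using i(3) j(4) by (simp_all add: walk_time_def)
    then show ?thesis using b by linarith
  next
    case 7
    then have "base i + A i \<le> \<theta>" "\<theta> < base i + L i"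
      using i(4) j(3) by (simp_all add: walk_time_def)
    then show ?thesis using b by linarith
  next
    case 8
    then have "base i \<le> \<theta>" "\<theta> < base i - G i"
      using i(3) j(4) by (simp_all add: walk_time_def)
    then show ?thesis using b by linarith
  next
    case 9
    then have "base j \<le> \<theta>" "\<theta> < base j - G j"
      using i(4) j(3) by (simp_all add: walk_time_def)
    then show ?thesis using b by linarith
  qed simp
qed

lemma walk_rate_le_cap: "i \<in> J \<Longrightarrow> m < 10 \<Longrightarrow> c / L i \<le> cap (walk_edge i m)"
  using c_pos bounds(1)[OF J_in_I, of i] bounds(1)[OF src_in, of i] bounds(1)[OF snk_in, of i]
    L_src[of i] L_snk[of i] unfolding less_10_cases
  by (elim disjE) (simp_all add: walk_edge_def frac_le)

lemma walk_flow_capacity: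
  assumes e: "e \<in> Ed" and vw: "v \<noteq> w"
  shows "walk_flow (to_nat e, v, w) \<theta> + walk_flow (to_nat e, w, v) \<theta> \<le> cap e"
proof -
  let ?g = "\<lambda>(i, m). if walk_edge i m = e then pulse (walk_time i m) (L i) (c / L i) \<theta> else 0"
  have nonneg: "0 \<le> pulse t (L i) (c / L i) \<theta>" if "i \<in> J" for i t
    using c_pos bounds(1)[OF J_in_I[OF that]] by (simp add: pulse_def)
  have "walk_flow (to_nat e, v, w) \<theta> + walk_flow (to_nat e, w, v) \<theta>
      \<le> (\<Sum>i\<in>J. \<Sum>m<10. ?g (i, m))"
    unfolding walk_flow_def sum.distrib[symmetric]
    by (intro sum_mono) (use vw nonneg in \<open>auto simp: walk_arc_def\<close>)
  also have "\<dots> = sum ?g (J \<times> {..<10})"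
    by (simp add: sum.cartesian_product)
  also have "\<dots> \<le> cap e"
  proof (rule sum_le_if_unique_nonzero)
    show "finite (J \<times> {..<10::nat})" using finite_J by simp
    show "0 \<le> cap e" using cap_nonneg[OF e] .
    show "?g x \<le> cap e" if "x \<in> J \<times> {..<10}" for x
      using that cap_nonneg[OF e] walk_rate_le_cap by (auto simp: pulse_def)
    show "x = y" if "x \<in> J \<times> {..<10}" "y \<in> J \<times> {..<10}" "?g x \<noteq> 0" "?g y \<noteq> 0" for x y
      using that active_walk_unique[of "fst x" "snd x" \<theta> "fst y" "snd y"]
      by (auto simp: pulse_def split: if_splits)
  qed
  finally show ?thesis .
qed

lemma excess_network:
  assumes "v \<in> V"
  shows "excess (bidirection network) (\<lambda>(e, _). transit network e) walk_flow (to_nat v) \<theta>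
    = (case v of Source i \<Rightarrow> - pulse_total (L i) (c / L i) \<theta>
        | Sink i \<Rightarrow> pulse_total (L i) (c / L i) (\<theta> - (T - L i)) | _ \<Rightarrow> 0)"
proof -
  have v: "to_nat v \<in> verts (bidirection network)"
    using assms by (simp add: bidirection_def network_def)
  have "excess (bidirection network) (\<lambda>(e, _). transit network e) walk_flow (to_nat v) \<theta>
      = (\<Sum>i\<in>J. (if Sink i = v then pulse_total (L i) (c / L i) (\<theta> - (T - L i)) else 0)
          - (if Source i = v then pulse_total (L i) (c / L i) \<theta> else 0))"
    unfolding excess_walk_flow[OF v] by (simp add: walk_vertex_def walk_time_def[of _ 10] cong: if_cong)
  then show ?thesis
    using assms finite_J by (auto simp: V_def sum_negf)
qed

lemma undirected_can_send_network: "undirected_can_send network (c * card J)"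
proof -
  have pb: "0 \<le> pulse_total (L i) (c / L i) y" "pulse_total (L i) (c / L i) y \<le> c"
    "pulse_total (L i) (c / L i) (L i) = c" if "i \<in> J" for i y
    using pulse_total_bounds[OF bounds(1)[OF J_in_I[OF that]] c_pos] by auto
  have "flow_conservation (bidirection network) (\<lambda>(e, _). transit network e) (balance network) T walk_flow"
    unfolding flow_conservation_def
  proof
    fix v' assume "v' \<in> verts (bidirection network)"
    then obtain v where v: "v \<in> V" "v' = to_nat v" by (auto simp: bidirection_def network_def)
    show "(balance network v' = 0 \<longrightarrow> excess (bidirection network) (\<lambda>(e, _). transit network e) walk_flow v' T = 0 \<and>
         (\<forall>\<theta>\<in>{0..T}. 0 \<le> excess (bidirection network) (\<lambda>(e, _). transit network e) walk_flow v' \<theta>)) \<and>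
       (0 < balance network v' \<longrightarrow> (\<forall>\<theta>\<in>{0..T}. - balance network v' \<le> excess (bidirection network) (\<lambda>(e, _). transit network e) walk_flow v' \<theta> \<and>
         excess (bidirection network) (\<lambda>(e, _). transit network e) walk_flow v' \<theta> \<le> 0)) \<and>
       (balance network v' < 0 \<longrightarrow> (\<forall>\<theta>\<in>{0..T}. 0 \<le> excess (bidirection network) (\<lambda>(e, _). transit network e) walk_flow v' \<theta> \<and>
         excess (bidirection network) (\<lambda>(e, _). transit network e) walk_flow v' \<theta> \<le> - balance network v'))"
      unfolding v(2) excess_network[OF v(1)]
      using v(1) c_pos pb by (auto simp: network_def V_def)
  qed
  moreover have "walk_flow (e, v, w) \<theta> + walk_flow (e, w, v) \<theta> \<le> capacity network e"
    if e: "e \<in> edges network" "ends network e = {v, w}" for e v w \<theta>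
  proof -
    obtain e' where e': "e' \<in> Ed" "e = to_nat e'" using e(1) by (auto simp: network_def)
    then have "v \<noteq> w"
      using joins_distinct[OF e'(1)] e(2) by (auto simp: network_def doubleton_eq_iff)
    then show ?thesis
      using walk_flow_capacity[OF e'(1)] by (simp add: network_def e'(2))
  qed
  ultimately have "undirected_flow_over_time network walk_flow"
    using inflow_rates_walk_flow by (simp add: undirected_flow_over_time_def network_def)
  moreover have "flow_value (bidirection network) (\<lambda>(e, _). transit network e) (balance network) (horizon network) walk_flow
      = c * card J"
  proof -
    have "flow_value (bidirection network) (\<lambda>(e, _). transit network e) (balance network) (horizon network) walk_flow
      = (\<Sum>v\<in>to_nat ` V. if bal (from_nat v) < 0
          then excess (bidirection network) (\<lambda>(e, _). transit network e) walk_flow v T else 0)"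
    proof -
      have "verts (bidirection network) = to_nat ` V" "balance network = (\<lambda>v. bal (from_nat v))" "horizon network = T"
        by (simp_all add: bidirection_def network_def)
      then show ?thesis
        unfolding flow_value_def using finite_V by (simp add: sum.inter_filter)
    qed
    also have "\<dots> = (\<Sum>v\<in>V. if bal v < 0
          then excess (bidirection network) (\<lambda>(e, _). transit network e) walk_flow (to_nat v) T else 0)"
      by (simp add: sum.reindex cong: if_cong)
    also have "\<dots> = (\<Sum>v\<in>V. case v of Sink i \<Rightarrow> c | _ \<Rightarrow> 0)"
      using c_pos by (intro sum.cong refl) (auto simp: excess_network pb V_def)
    also have "\<dots> = c * card J" by (simp add: sum_V)
    finally show ?thesis .
  qed
  ultimately show ?thesis
    unfolding undirected_can_send_def by (intro exI[of _ walk_flow]) simp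
qed

end

text \<open>
  Gadgets are pairs \<open>(l, v)\<close>, whose scale \<open>len (l, v)\<close> is lexicographically increasing in \<open>(v, l)\<close>. Role S
  leads from \<open>(l, v)\<close> to \<open>(l + 1, v)\<close>, role P to \<open>(l + 1, v - 2 ^ l)\<close>. Because \<open>2 ^ l\<close> exceeds the
  sum of all smaller powers of 2, every gadget from which \<open>src i\<close> can be reached has a much smaller
  scale than the gadget whose role P precedes role D at \<open>i\<close>. With a step of \<open>1\<close> instead of
  \<open>2 ^ l\<close>, flows that cross a star from \<open>b\<close> to \<open>a\<close> would provide useful detours.
\<close>

locale scale =
  fixes n :: nat and K c :: real
  assumes K_ge: "4 * n + 10 \<le> K" and c_gt: "0 < c"
begin

definition rows :: nat where "rows = 2 ^ n * (n + 1)"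

definition gadgets :: "(nat \<times> nat) set" where "gadgets = {..n} \<times> {..<rows}"

definition paths :: "(nat \<times> nat) set" where "paths = {1..<n} \<times> {2 ^ n..<rows}"

fun src_of :: "nat \<times> nat \<Rightarrow> nat \<times> nat" where
  "src_of (l, v) = (l - 1, v)"

fun snk_of :: "nat \<times> nat \<Rightarrow> nat \<times> nat" where
  "snk_of (l, v) = (l + 1, v - 2 ^ l)"

definition R :: "nat \<Rightarrow> real" where
  "R v = K ^ (n + (n + 1) * v)"

fun len :: "nat \<times> nat \<Rightarrow> real" where
  "len (l, v) = K ^ (l + 1) * R v"

fun late :: "nat \<times> nat \<Rightarrow> real" where
  "late (l, v) = (K + (4 * n + 6)) * K ^ l * R v"

fun gap :: "nat \<times> nat \<Rightarrow> real" where
  "gap (l, v) = (2 * n + 4) * R (v + 2 ^ l div 2)"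

fun late_max :: "nat \<times> nat \<Rightarrow> real" where
  "late_max (l, v) = 2 * (real n + 1 - l) * R (v + 1)"

fun early_max :: "nat \<times> nat \<Rightarrow> real" where
  "early_max (l, v) = (2 * l + 1) * R (v + 2 ^ l)"

fun early_min :: "nat \<times> nat \<Rightarrow> real" where
  "early_min (l, v) = 4 * K ^ l * R v"

definition bound :: real where "bound = 2 * (n + 1) * R (rows + 2 ^ n)"

lemma K_gt_1: "1 < K" and K_ge_2: "2 \<le> K"
  using K_ge by auto

lemma R_pos: "0 < R v"
  using K_gt_1 by (simp add: R_def)

lemma R_mono: "v \<le> w \<Longrightarrow> R v \<le> R w"
  unfolding R_def using K_gt_1 by (intro power_increasing add_left_mono mult_left_mono) auto

lemma R_Suc: "R (Suc v) = K ^ (n + 1) * R v"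
  by (simp add: R_def power_add)

lemma power_R_le: "l \<le> n + 1 \<Longrightarrow> K ^ l * R v \<le> R (Suc v)"
  unfolding R_Suc using K_gt_1 R_pos[of v] by (intro mult_right_mono power_increasing) auto

lemma K_R_le: "K * R v \<le> R (Suc v)"
  using power_R_le[of 1 v] by simp

lemma late_le:
  assumes "l \<le> n"
  shows "late (l, v) \<le> 2 * K ^ (l + 1) * R v" "late (l, v) \<le> 2 * R (Suc v)"
proof -
  have "(K + (4 * n + 6)) * (K ^ l * R v) \<le> 2 * K * (K ^ l * R v)"
    using K_ge K_gt_1 R_pos[of v] by (intro mult_right_mono) auto
  then show "late (l, v) \<le> 2 * K ^ (l + 1) * R v" by (simp add: mult.assoc)
  also have "2 * K ^ (l + 1) * R v \<le> 2 * R (Suc v)"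
    using power_R_le[of "l + 1" v] assms by simp
  finally show "late (l, v) \<le> 2 * R (Suc v)" .
qed

lemma power_half: "l \<noteq> 0 \<Longrightarrow> (2 :: nat) ^ l div 2 = 2 ^ (l - 1)"
  by (cases l) auto

lemma two_power_half_less: "(2 :: nat) ^ l div 2 + 1 \<le> 2 ^ l"
  by (cases l) auto

lemma gap_bound: "(2 * n + 4) * R v \<le> R (Suc v)"
proof -
  have "(2 * n + 4) * R v \<le> K * R v"
    using K_ge R_pos[of v] by (intro mult_right_mono) auto
  then show ?thesis using K_R_le[of v] by simp
qed

lemma scale_bounds:
  assumes "l \<le> n" "v < rows"
  shows "0 < len (l, v)" "len (l, v) \<le> late (l, v)" "late (l, v) \<le> late_max (l, v)" "late_max (l, v) \<le> bound"
    "0 \<le> early_min (l, v)" "early_min (l, v) \<le> gap (l, v)" "gap (l, v) \<le> early_max (l, v)" "early_max (l, v) \<le> bound"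
    "bound * (l + 1) + bound \<le> bound * (n + 2)"
proof -
  have bound: "0 < bound" using R_pos by (simp add: bound_def)
  show "0 < len (l, v)" using K_gt_1 R_pos by simp
  have "K * (K ^ l * R v) \<le> (K + (4 * n + 6)) * (K ^ l * R v)"
    using K_gt_1 R_pos[of v] by (intro mult_right_mono) auto
  then show "len (l, v) \<le> late (l, v)" by (simp add: mult.assoc)
  have "2 * 1 * R (v + 1) \<le> 2 * (real n + 1 - l) * R (v + 1)"
    using assms R_pos[of "v + 1"] by (intro mult_right_mono mult_left_mono) auto
  then show "late (l, v) \<le> late_max (l, v)" using late_le(2)[OF assms(1), of v] by simp
  show "late_max (l, v) \<le> bound"
    unfolding bound_def late_max.simps using assms R_pos[of "v + 1"] R_mono[of "v + 1" "rows + 2 ^ n"]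
    by (intro mult_mono) auto
  show "0 \<le> early_min (l, v)" using K_gt_1 R_pos[of v] by simp
  show "early_min (l, v) \<le> gap (l, v)"
  proof -
    have "K ^ l * R v \<le> R (v + 2 ^ l div 2)"
    proof (cases "l = 0")
      case False
      then have "R (Suc v) \<le> R (v + 2 ^ l div 2)"
        by (intro R_mono) (simp add: power_half)
      then show ?thesis using power_R_le[of l v] assms by simp
    qed simp
    then have "4 * (K ^ l * R v) \<le> (2 * n + 4) * R (v + 2 ^ l div 2)"
      using K_gt_1 R_pos[of v] by (intro mult_mono) auto
    then show ?thesis by simp
  qed
  have "R (Suc (v + 2 ^ l div 2)) \<le> R (v + 2 ^ l)"
    using two_power_half_less[of l] by (intro R_mono) simp
  also have "\<dots> \<le> (2 * l + 1) * R (v + 2 ^ l)"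
    using R_pos[of "v + 2 ^ l"] by (simp add: algebra_simps)
  finally show "gap (l, v) \<le> early_max (l, v)"
    using gap_bound[of "v + 2 ^ l div 2"] by (simp add: add.commute)
  have "v + 2 ^ l \<le> rows + 2 ^ n" using assms by (intro add_mono power_increasing) auto
  from R_mono[OF this] show "early_max (l, v) \<le> bound"
    unfolding bound_def early_max.simps using assms R_pos[of "v + 2 ^ l"]
    by (intro mult_mono) auto
  have "bound * (real l + 2) \<le> bound * (n + 2)"
    using bound assms by (intro mult_left_mono) auto
  then show "bound * (l + 1) + bound \<le> bound * (n + 2)" by (simp add: algebra_simps)
qed

lemma scale_path_bounds:
  assumes "1 \<le> l" "l < n" "2 ^ n \<le> v"
  shows "len (src_of (l, v)) \<le> len (l, v)" "len (snk_of (l, v)) \<le> len (l, v)"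
    "len (l, v) + gap (snk_of (l, v)) + late_max (snk_of (l, v)) \<le> late (l, v)"
    "late_max (l, v) + late (src_of (l, v)) \<le> late_max (src_of (l, v))"
    "early_max (src_of (l, v)) + late (src_of (l, v)) \<le> gap (l, v)"
    "early_max (l, v) + len (l, v) + gap (snk_of (l, v)) \<le> early_max (snk_of (l, v))"
    "early_min (src_of (l, v)) + late (src_of (l, v)) \<le> early_min (l, v)"
proof -
  obtain k where k: "l = Suc k" using assms(1) by (cases l) auto
  have le: "(2::nat) ^ l \<le> v" using assms by (intro order_trans[OF power_increasing assms(3)]) auto
  have half: "(2::nat) ^ (l + 1) div 2 = 2 ^ l" by simp
  have pos: "0 < (2::nat) ^ l" by simp
  then have snkv: "Suc (v - 2 ^ l) \<le> v" using le by linarith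
  show "len (src_of (l, v)) \<le> len (l, v)"
    using K_gt_1 R_pos[of v] by (simp add: k)
  show "len (snk_of (l, v)) \<le> len (l, v)"
  proof -
    have "K ^ (l + 2) * R (v - 2 ^ l) \<le> K * (K ^ (l + 1) * R (v - 2 ^ l))" by simp
    also have "\<dots> \<le> K * R (Suc (v - 2 ^ l))"
      using assms K_gt_1 by (intro mult_left_mono power_R_le) auto
    also have "\<dots> \<le> K * R v"
      using K_gt_1 R_mono[OF snkv] by simp
    also have "\<dots> \<le> K ^ (l + 1) * R v"
      using K_gt_1 R_pos[of v] by (intro mult_right_mono) (auto intro: self_le_power)
    finally show ?thesis by simp
  qed
  show "len (l, v) + gap (snk_of (l, v)) + late_max (snk_of (l, v)) \<le> late (l, v)"
  proof -
    have "gap (snk_of (l, v)) = (2 * n + 4) * R v"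
      using le half by simp
    moreover have "late_max (snk_of (l, v)) \<le> 2 * n * R v"
    proof -
      have "2 * (real n + 1 - (l + 1)) * R (Suc (v - 2 ^ l)) \<le> 2 * n * R v"
        using assms R_mono[OF snkv] R_pos[of "Suc (v - 2 ^ l)"] by (intro mult_mono) auto
      then show ?thesis by simp
    qed
    moreover have "(4 * n + 6) * (1 * R v) \<le> (4 * n + 6) * (K ^ l * R v)"
      using K_gt_1 R_pos[of v] by (intro mult_left_mono mult_right_mono) (auto intro: one_le_power)
    moreover have "(2 * n + 4) * R v + 2 * n * R v \<le> (4 * n + 6) * (1 * R v)"
      using R_pos[of v] by (simp add: algebra_simps)
    moreover have "late (l, v) = len (l, v) + (4 * n + 6) * (K ^ l * R v)"
      by (simp add: algebra_simps)
    ultimately show ?thesis by linarith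
  qed
  show "late_max (l, v) + late (src_of (l, v)) \<le> late_max (src_of (l, v))"
    using late_le(2)[of k v] assms by (simp add: k algebra_simps)
  have "R (Suc v) \<le> R (v + 2 ^ k)" by (intro R_mono) simp
  then have lk: "late (k, v) \<le> 2 * R (v + 2 ^ k)" using late_le(2)[of k v] assms k by simp
  show "early_max (src_of (l, v)) + late (src_of (l, v)) \<le> gap (l, v)"
  proof -
    have "(2 * real k + 1) * R (v + 2 ^ k) + 2 * R (v + 2 ^ k) = (2 * k + 3) * R (v + 2 ^ k)"
      by (simp add: algebra_simps)
    also have "\<dots> \<le> (2 * n + 4) * R (v + 2 ^ k)"
      using assms k R_pos[of "v + 2 ^ k"] by (intro mult_right_mono) auto
    finally show ?thesis using lk by (simp add: k)
  qed
  show "early_max (l, v) + len (l, v) + gap (snk_of (l, v)) \<le> early_max (snk_of (l, v))"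
  proof -
    have r: "R (Suc v) \<le> R (v + 2 ^ l)" using pos by (intro R_mono) simp
    have "len (l, v) \<le> R (v + 2 ^ l)"
      using power_R_le[of "l + 1" v] assms r by simp
    moreover have "gap (snk_of (l, v)) \<le> R (v + 2 ^ l)"
      using gap_bound[of v] r le half by simp
    moreover have "v - 2 ^ l + 2 ^ (l + 1) = v + 2 ^ l" using le by simp
    then have "early_max (snk_of (l, v)) = (2 * real l + 1) * R (v + 2 ^ l) + 2 * R (v + 2 ^ l)"
      by (simp add: algebra_simps)
    ultimately show ?thesis by simp
  qed
  show "early_min (src_of (l, v)) + late (src_of (l, v)) \<le> early_min (l, v)"
  proof -
    have "2 * (K ^ k * R v) \<le> K * (K ^ k * R v)"
      using K_ge_2 K_gt_1 R_pos[of v] by (intro mult_right_mono) auto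
    then show ?thesis using late_le(1)[of k v] assms k by simp
  qed
qed

sublocale gadget_network gadgets paths src_of snk_of fst len late gap late_max early_max early_min bound c "bound * (n + 2)"
proof
  show "finite gadgets" "paths \<subseteq> gadgets"
    by (auto simp: gadgets_def paths_def)
  show "inj_on src_of paths" "inj_on snk_of paths"
  proof -
    show "inj_on src_of paths" by (auto simp: inj_on_def paths_def)
    have "(2::nat) ^ l \<le> 2 ^ n" if "l < n" for l
      using that by (intro power_increasing) auto
    then have "v = w" if "v - 2 ^ l = w - 2 ^ l" "l < n" "2 ^ n \<le> v" "2 ^ n \<le> w" for v w l :: nat
      using that by (metis eq_diff_iff order_trans)
    then show "inj_on snk_of paths" by (auto simp: inj_on_def paths_def)
  qed
  show "0 < c" by (rule c_gt)
  fix g assume "g \<in> gadgets"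
  then show "0 < len g \<and> len g \<le> late g \<and> late g \<le> late_max g \<and> late_max g \<le> bound \<and>
      0 \<le> early_min g \<and> early_min g \<le> gap g \<and> gap g \<le> early_max g \<and> early_max g \<le> bound
      \<and> bound * (fst g + 1) + bound \<le> bound * (n + 2)"
    using scale_bounds[of "fst g" "snd g"] by (auto simp: gadgets_def add.commute simp del: len.simps late.simps gap.simps
        late_max.simps early_max.simps early_min.simps)
next
  fix i assume i: "i \<in> paths"
  then show "src_of i \<in> gadgets" "snk_of i \<in> gadgets" "fst i = Suc (fst (src_of i))" "fst (snk_of i) = Suc (fst i)"
    by (auto simp: paths_def gadgets_def)
  obtain l v where lv: "i = (l, v)" by (cases i)
  then have "1 \<le> l" "l < n" "2 ^ n \<le> v" using i by (auto simp: paths_def)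
  note b = scale_path_bounds[OF this]
  show "len (src_of i) \<le> len i" "len (snk_of i) \<le> len i" "len i + gap (snk_of i) + late_max (snk_of i) \<le> late i"
    "late_max i + late (src_of i) \<le> late_max (src_of i)" "early_max (src_of i) + late (src_of i) \<le> gap i"
    "early_max i + len i + gap (snk_of i) \<le> early_max (snk_of i)" "early_min (src_of i) + late (src_of i) \<le> early_min i"
    unfolding lv by (rule b)+
qed

lemma card_gadgets: "card gadgets = (n + 1) * (n + 1) * 2 ^ n"
  by (simp add: gadgets_def rows_def algebra_simps)

lemma card_paths: "card paths = (n - 1) * n * 2 ^ n"
  by (simp add: paths_def rows_def)

lemma late_early_le: "g \<in> gadgets \<Longrightarrow> late g + early_min g \<le> (1 + (4 * n + 10) / K) * len g"
  using K_gt_1 by (cases g) (simp add: field_simps)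

end

theorem theorem2:
  fixes \<epsilon> B :: real
  assumes "\<epsilon> > 0" and "B > 0"
  shows "\<exists>N :: (nat, nat) undirected_network.
           undirected_network_over_time N \<and>
           total_supply N = B \<and>
           undirected_can_send N B \<and>
           (\<forall>D. is_orientation N D \<longrightarrow> (\<forall>x. directed_can_send D x \<longrightarrow> x \<le> B / 3 + \<epsilon>))"
proof -
  have "((\<lambda>n. (1 + 1 / real n) * ((real n + 1) * (real n + 1) / ((real n - 1) * real n))) \<longlongrightarrow> 1) at_top"
    by real_asymp
  then have "\<forall>\<^sub>F n in at_top. (1 + 1 / real n) * ((real n + 1) * (real n + 1) / ((real n - 1) * real n)) < 1 + 3 * \<epsilon> / B"
    using assms by (intro order_tendstoD(2)) auto
  then have "\<forall>\<^sub>F n :: nat in at_top. 2 \<le> n \<and>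
      (1 + 1 / real n) * ((real n + 1) * (real n + 1) / ((real n - 1) * real n)) < 1 + 3 * \<epsilon> / B"
    by (intro eventually_conj eventually_ge_at_top)
  then obtain n :: nat where n: "2 \<le> n"
    and ratio: "(1 + 1 / real n) * ((real n + 1) * (real n + 1) / ((real n - 1) * real n)) < 1 + 3 * \<epsilon> / B"
    by (auto dest!: eventually_happens'[OF sequentially_bot])
  define c where "c = B / ((real n - 1) * real n * 2 ^ n)"
  define K where "K = real n * (4 * real n + 10)"
  have den: "0 < (real n - 1) * real n * 2 ^ n" using n by auto
  interpret scale n K c
  proof
    have "1 * (4 * real n + 10) \<le> K"
      unfolding K_def using n by (intro mult_right_mono) auto
    then show "real (4 * n + 10) \<le> K" by simp
    show "0 < c" unfolding c_def using den assms by simp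
  qed
  have card_paths': "real (card paths) = (real n - 1) * real n * 2 ^ n"
    using n by (simp add: card_paths of_nat_diff)
  have card_gadgets': "real (card gadgets) = (real n + 1) * (real n + 1) * 2 ^ n"
    by (simp add: card_gadgets algebra_simps)
  have K_n: "real (4 * n + 10) / K = 1 / real n"
    using n by (simp add: K_def add_nonneg_eq_0_iff)
  have B: "c * card paths = B"
    unfolding card_paths' c_def using n by auto
  have "paths \<noteq> {}" using den card_paths' by auto
  then have "undirected_network_over_time network" by (rule network_wf)
  moreover have "x \<le> B / 3 + \<epsilon>" if D: "is_orientation network D" and x: "directed_can_send D x" for D x
  proof -
    obtain f where f: "directed_flow_over_time D f"
      "x \<le> flow_value (graph D) (dtransit D) (dbalance D) (dhorizon D) f"
      using x unfolding directed_can_send_def by blast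
    have cancel: "B / (d * p) * (a * p) = B * (a / d)" if "p \<noteq> 0" for a B d p :: real
      using that by simp
    have "3 * x \<le> (1 + (4 * n + 10) / K) * c * card gadgets"
    proof -
      have "3 * flow_value (graph D) (dtransit D) (dbalance D) (dhorizon D) f
          \<le> (1 + (4 * n + 10) / K) * c * card gadgets"
        using K_gt_1 by (intro orientation_flow_value[OF D f(1)] late_early_le) auto
      then show ?thesis using f(2) by linarith
    qed
    also have "\<dots> = (1 + 1 / real n) * (B / ((real n - 1) * real n * 2 ^ n) * ((real n + 1) * (real n + 1) * 2 ^ n))"
      by (simp only: K_n card_gadgets' c_def mult.assoc)
    also have "\<dots> = (1 + 1 / real n) * (B * ((real n + 1) * (real n + 1) / ((real n - 1) * real n)))"
      by (subst cancel) simp_all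
    also have "\<dots> = B * ((1 + 1 / real n) * ((real n + 1) * (real n + 1) / ((real n - 1) * real n)))"
      by (rule mult.left_commute)
    also have "\<dots> \<le> B * (1 + 3 * \<epsilon> / B)"
      using ratio assms by (intro mult_left_mono) auto
    also have "\<dots> = B + 3 * \<epsilon>" using assms by (simp add: field_simps)
    finally show ?thesis by simp
  qed
  ultimately show ?thesis
    using total_supply_network undirected_can_send_network unfolding B
    by (intro exI[of _ network] conjI allI impI)
qed

end
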